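(* Let $\mathcal{G}(t;x,u,v,q,z)$ be the generating function of permutations defined by $$\mathcal{G}(t;x,u,v,q,z)=\sum_{n=1}^{\infty}t^n\sum_{\pi\in\mathfrak{S}_n}\frac{u^{\mathsf{des}(\pi)}x^{\mathsf{ides}(\pi)}q^{\mathsf{lmin}(\pi)}v^{\mathsf{rmax}(\pi)}z^{\mathsf{lmax}(\pi)}}{(1-u)^n(1-x)^n}.$$ Put $r=1-t$. Then $$\mathcal{G}(t;x,u,v,q,1)=\frac{vt}{1-x}\sum_{n=1}^{\infty}\frac{qx-1+(1-q)r^{n-1}}{x-r^n}\prod_{i=1}^{n-1}\frac{u(x-r^i-xvt)\big((1-qt)r^{i-1}-1\big)}{(r^{i}-1)(x-r^i)}$$ $$\times\left(1-\frac{ut(q-1)}{x-1}\sum_{n=1}^{\infty}\frac{(x-1-xv)r^{n-1}+xv}{r^n-1}\prod_{i=1}^{n-1}\frac{u(x-r^i-xvt)\big((1-qt)r^{i-1}-1\big)}{(r^{i}-1)(x-r^i)}\right)^{-1}.$$ Furthermore, $$\mathcal{G}(t;x,u,v,q,1)=\mathcal{G}(t;x,u,q,v,1)=\mathcal{G}(t;u,x,q,v,1),$$ namely, for every $n\ge 1$ the quadruples $(\mathsf{des},\mathsf{ides},\mathsf{rmax},\mathsf{lmin})$, $(\mathsf{des},\mathsf{ides},\mathsf{lmin},\mathsf{rmax})$ and $(\mathsf{ides},\mathsf{des},\mathsf{rmax},\mathsf{lmin})$ are all equidistributed over $\mathfrak{S}_n$.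
   Context: $\mathfrak{S}_n$ is the set of permutations $\pi=\pi_1\pi_2\cdots\pi_n$ of $[n]=\{1,\dots,n\}$. $\mathsf{des}(\pi)=|\{i\in[n-1]:\pi_i>\pi_{i+1}\}|$ (descents); $\mathsf{ides}(\pi)=\mathsf{des}(\pi^{-1})$; $\mathsf{lmax}(\pi)=|\{\pi_i:\pi_i>\pi_j\text{ for all }j<i\}|$ (left-to-right maxima); $\mathsf{lmin}(\pi)=|\{\pi_i:\pi_i<\pi_j\text{ for all }j<i\}|$ (left-to-right minima); $\mathsf{rmax}(\pi)=|\{\pi_i:\pi_i>\pi_j\text{ for all }j>i\}|$ (right-to-left maxima). Empty products equal $1$. Two tuples of statistics are equidistributed over a finite set if each tuple of values is attained by the same number of elements of the set. The formula is an identity of formal power series in $u$ whose coefficients are power series in $x$ and $t$ with coefficients polynomial in $v,q$: the $n$-th summand of each sum carries the factor $u^{n-1}$ coming from the product, $\frac{(1-qt)r^{i-1}-1}{r^i-1}$ and $\frac{t}{r^n-1}$ are read as power series in $t$ (common factor $t$ cancelled), and $\frac1{x-r^n}$, $\frac1{1-x}$, $\frac1{1-u}$ are expanded as power series. *)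

theory Defs
  imports
    "HOL-Computational_Algebra.Formal_Power_Series"
    "HOL-Combinatorics.Permutations"
begin

unbundle fps_syntax

text \<open>A permutation \<open>\<pi>\<close> of \<open>[n]\<close> is a function with \<^term>\<open>\<pi> permutes {1..n}\<close>;
  its one-line word is \<open>\<pi> 1, \<dots>, \<pi> n\<close>.\<close>

definition perms :: "nat \<Rightarrow> (nat \<Rightarrow> nat) set" where
  "perms n = {\<pi>. \<pi> permutes {1..n}}"

definition des :: "nat \<Rightarrow> (nat \<Rightarrow> nat) \<Rightarrow> nat" where
  "des n \<pi> = card {i \<in> {1..n - 1}. \<pi> i > \<pi> (i + 1)}"

definition ides :: "nat \<Rightarrow> (nat \<Rightarrow> nat) \<Rightarrow> nat" where
  "ides n \<pi> = des n (inv \<pi>)"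

definition lmax :: "nat \<Rightarrow> (nat \<Rightarrow> nat) \<Rightarrow> nat" where
  "lmax n \<pi> = card {\<pi> i | i. i \<in> {1..n} \<and> (\<forall>j \<in> {1..n}. j < i \<longrightarrow> \<pi> i > \<pi> j)}"

definition lmin :: "nat \<Rightarrow> (nat \<Rightarrow> nat) \<Rightarrow> nat" where
  "lmin n \<pi> = card {\<pi> i | i. i \<in> {1..n} \<and> (\<forall>j \<in> {1..n}. j < i \<longrightarrow> \<pi> i < \<pi> j)}"

definition rmax :: "nat \<Rightarrow> (nat \<Rightarrow> nat) \<Rightarrow> nat" where
  "rmax n \<pi> = card {\<pi> i | i. i \<in> {1..n} \<and> (\<forall>j \<in> {1..n}. j > i \<longrightarrow> \<pi> i > \<pi> j)}"

definition equidistributed :: "'s set \<Rightarrow> ('s \<Rightarrow> 'w) \<Rightarrow> ('s \<Rightarrow> 'w) \<Rightarrow> bool" where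
  "equidistributed S f g \<longleftrightarrow> (\<forall>w. card {s \<in> S. f s = w} = card {s \<in> S. g s = w})"

text \<open>Power series in \<open>u\<close> over power series in \<open>x\<close> over power series in \<open>t\<close> over a field \<open>K\<close>
  of characteristic zero: \<open>F $ k $ j $ m\<close> is the coefficient of \<open>u\<^sup>k x\<^sup>j t\<^sup>m\<close>.
  The parameters \<open>v\<close> and \<open>q\<close> are arbitrary elements of an arbitrary such \<open>K\<close>. This includes two
  independent indeterminates (\<open>K = \<rat>(v, q)\<close>, or the type \<open>rat fls fls\<close>, which contains it), for which
  one obtains the identities with coefficients polynomial in \<open>v\<close> and \<open>q\<close>.

  A nested series has an inverse as soon as its iterated constant term is nonzero;
  \<open>inverse\<close> and \<open>/\<close> on nested series are used for such denominators only.
  In \<^typ>\<open>'a fps\<close> itself (one variable \<open>t\<close>, field coefficients), \<open>f / g\<close> cancels the common power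
  of \<open>t\<close>.\<close>

type_synonym 'a fps3 = "'a fps fps fps"

definition const_t :: "'a::zero fps \<Rightarrow> 'a fps3" where
  "const_t f = fps_const (fps_const f)"

definition const_K :: "'a::zero \<Rightarrow> 'a fps3" where
  "const_K c = const_t (fps_const c)"

definition var_t :: "'a::{zero,one} fps3" where "var_t = const_t fps_X"
definition var_x :: "'a::{zero,one} fps3" where "var_x = fps_const fps_X"
definition var_u :: "'a::{zero,one} fps3" where "var_u = fps_X"

text \<open>Infinite sums are taken coefficientwise. Neither the \<open>t\<close>-adic nor the \<open>u\<close>-adic topology
  alone would do: the series for \<open>gen_fun\<close> converges only \<open>t\<close>-adically, the two series of the
  closed formula only \<open>u\<close>-adically.\<close>

definition fps3_summable :: "(nat \<Rightarrow> 'a::comm_monoid_add fps3) \<Rightarrow> nat set \<Rightarrow> bool" where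
  "fps3_summable F A \<longleftrightarrow> (\<forall>k j m. finite {n \<in> A. F n $ k $ j $ m \<noteq> 0})"

definition fps3_infsum :: "(nat \<Rightarrow> 'a::comm_monoid_add fps3) \<Rightarrow> nat set \<Rightarrow> 'a fps3" where
  "fps3_infsum F A = Abs_fps (\<lambda>k. Abs_fps (\<lambda>j. Abs_fps (\<lambda>m.
     \<Sum>n \<in> {n \<in> A. F n $ k $ j $ m \<noteq> 0}. F n $ k $ j $ m)))"

definition gen_fun_term ::
  "'a::field_char_0 fps3 \<Rightarrow> 'a fps3 \<Rightarrow> 'a fps3 \<Rightarrow> 'a fps3 \<Rightarrow> 'a fps3 \<Rightarrow> 'a fps3 \<Rightarrow> nat \<Rightarrow> 'a fps3"
where
  "gen_fun_term t x u v q z n =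
     t ^ n * (\<Sum>\<pi>\<in>perms n.
       (u ^ des n \<pi> * x ^ ides n \<pi> * q ^ lmin n \<pi> * v ^ rmax n \<pi> * z ^ lmax n \<pi>) /
       ((1 - u) ^ n * (1 - x) ^ n))"

definition gen_fun ::
  "'a::field_char_0 fps3 \<Rightarrow> 'a fps3 \<Rightarrow> 'a fps3 \<Rightarrow> 'a fps3 \<Rightarrow> 'a fps3 \<Rightarrow> 'a fps3 \<Rightarrow> 'a fps3"
where
  "gen_fun t x u v q z = fps3_infsum (gen_fun_term t x u v q z) {1..}"

text \<open>The series \<open>r = 1 - t\<close>, in \<open>K[[t]]\<close> and in the full ring.\<close>

definition r_t :: "'a::field_char_0 fps" where "r_t = 1 - fps_X"
definition r_series :: "'a::field_char_0 fps3" where "r_series = 1 - var_t"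

definition factor_ratio :: "'a::field_char_0 \<Rightarrow> nat \<Rightarrow> 'a fps" where
  "factor_ratio q i = ((1 - fps_const q * fps_X) * r_t ^ (i - 1) - 1) / (r_t ^ i - 1)"

definition partial_product :: "'a::field_char_0 \<Rightarrow> 'a \<Rightarrow> nat \<Rightarrow> 'a fps3" where
  "partial_product v q n =
     (\<Prod>i = 1..n - 1.
        var_u * (var_x - r_series ^ i - var_x * const_K v * var_t) * const_t (factor_ratio q i) /
        (var_x - r_series ^ i))"

definition numerator_term :: "'a::field_char_0 \<Rightarrow> 'a \<Rightarrow> nat \<Rightarrow> 'a fps3" where
  "numerator_term v q n =
     (const_K q * var_x - 1 + (1 - const_K q) * r_series ^ (n - 1)) / (var_x - r_series ^ n) *
     partial_product v q n"

text \<open>The factor \<open>t\<close> standing in front of the second sum is moved inside, so that \<open>t / (r\<^sup>n - 1)\<close>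
  is a power series in \<open>t\<close>.\<close>

definition denominator_term :: "'a::field_char_0 \<Rightarrow> 'a \<Rightarrow> nat \<Rightarrow> 'a fps3" where
  "denominator_term v q n =
     ((var_x - 1 - var_x * const_K v) * r_series ^ (n - 1) + var_x * const_K v) *
     const_t (fps_X / (r_t ^ n - 1)) *
     partial_product v q n"

subsection \<open>Well-definedness of the divisions and infinite sums\<close>

lemma fps_mult_inverse_unit:
  fixes f :: "'b::{comm_ring_1,inverse} fps"
  assumes "f $ 0 * inverse (f $ 0) = 1"
  shows "f * inverse f = 1"
  using fps_right_inverse[of f "inverse (f $ 0)"] assms by (simp add: fps_inverse_def)

lemma fps_divide_mult_unit:
  fixes f :: "'b::{comm_ring_1,inverse} fps"
  assumes "f $ 0 * inverse (f $ 0) = 1"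
  shows "g / f * f = g"
proof -
  have "f $ 0 \<noteq> 0" using assms by auto
  hence "subdegree f = 0" by (simp add: subdegree_eq_0)
  moreover from this have "unit_factor f = f" by (simp add: fps_unit_factor_def)
  ultimately have "g / f = g * inverse f" by (simp add: fps_divide_def)
  hence "g / f * f = g * (f * inverse f)" by (simp only: ac_simps)
  thus ?thesis by (simp only: fps_mult_inverse_unit[OF assms] mult_1_right)
qed

lemma fps3_divide_mult:
  fixes f g :: "'a::field_char_0 fps3"
  assumes "f $ 0 $ 0 $ 0 \<noteq> 0"
  shows "g / f * f = g"
  by (intro fps_divide_mult_unit fps_mult_inverse_unit) (use assms in auto)

lemma fps3_mult_inverse:
  fixes f :: "'a::field_char_0 fps3"
  assumes "f $ 0 $ 0 $ 0 \<noteq> 0"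
  shows "f * inverse f = 1"
  by (intro fps_mult_inverse_unit) (use assms in auto)

lemma r_series_eq: "r_series = const_t r_t"
  unfolding r_series_def r_t_def var_t_def const_t_def
  by (simp only: fps_const_sub[symmetric] fps_const_1_eq_1)

lemma r_series_power_eq: "r_series ^ n = const_t (r_t ^ n)"
  by (simp add: r_series_eq const_t_def)

lemma fps3_denominators_nonzero:
  "(1 - var_u :: 'a::field_char_0 fps3) $ 0 $ 0 $ 0 \<noteq> 0"
  "(1 - var_x :: 'a fps3) $ 0 $ 0 $ 0 \<noteq> 0"
  "(var_x - 1 :: 'a fps3) $ 0 $ 0 $ 0 \<noteq> 0"
  "((1 - var_u) ^ n * (1 - var_x) ^ n :: 'a fps3) $ 0 $ 0 $ 0 \<noteq> 0"
  "(var_x - r_series ^ n :: 'a fps3) $ 0 $ 0 $ 0 \<noteq> 0"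
  "(1 - var_u * F / (var_x - 1) * S :: 'a fps3) $ 0 $ 0 $ 0 \<noteq> 0"
proof -
  show nz: "(var_x - 1 :: 'a fps3) $ 0 $ 0 $ 0 \<noteq> 0" by (simp add: var_x_def)
  have "(var_u * F / (var_x - 1)) $ 0 * (var_x - 1 :: 'a fps3) $ 0 = 0"
    using arg_cong[OF fps3_divide_mult[OF nz, of "var_u * F"], of "\<lambda>f. f $ 0"]
    by (simp add: var_u_def)
  moreover have "(var_x - 1 :: 'a fps3) $ 0 \<noteq> 0" using nz by auto
  ultimately have "(var_u * F / (var_x - 1)) $ 0 = 0" by simp
  thus "(1 - var_u * F / (var_x - 1) * S :: 'a fps3) $ 0 $ 0 $ 0 \<noteq> 0" by simp
qed (simp_all add: var_u_def var_x_def r_series_power_eq const_t_def r_t_def fps_power_zeroth)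

lemma r_t_power_sub_1:
  assumes "n \<ge> 1"
  shows "(r_t ^ n - 1 :: 'a::field_char_0 fps) = fps_X * (- (\<Sum>i<n. r_t ^ i))"
    and "(- (\<Sum>i<n. r_t ^ i) :: 'a fps) $ 0 \<noteq> 0"
proof -
  have "(r_t - 1) * (\<Sum>i<n. r_t ^ i) = (r_t ^ n - 1 :: 'a fps)"
    by (rule power_diff_1_eq[symmetric])
  thus "(r_t ^ n - 1 :: 'a fps) = fps_X * (- (\<Sum>i<n. r_t ^ i))"
    by (simp add: r_t_def)
  show "(- (\<Sum>i<n. r_t ^ i) :: 'a fps) $ 0 \<noteq> 0"
    using assms by (simp add: fps_sum_nth fps_power_zeroth r_t_def)
qed

lemma fps_X_dvd_divide_r_t:
  fixes f :: "'a::field_char_0 fps"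
  assumes "n \<ge> 1" and "f $ 0 = 0"
  shows "f / (r_t ^ n - 1) * (r_t ^ n - 1) = f"
proof (rule dvd_div_mult_self)
  have "is_unit (- (\<Sum>i<n. r_t ^ i) :: 'a fps)"
    using r_t_power_sub_1(2)[OF assms(1)] by (simp only: fps_is_unit_iff not_False_eq_True)
  hence "(r_t ^ n - 1) dvd (fps_X :: 'a fps)"
    unfolding r_t_power_sub_1(1)[OF assms(1)] by (simp only: mult_unit_dvd_iff dvd_refl)
  also have "fps_X dvd f" using assms(2)
    by (intro dvdI[of _ _ "fps_shift 1 f"])
      (simp add: fps_eq_iff fps_X_mult_nth)
  finally show "(r_t ^ n - 1) dvd f" .
qed

lemma r_t_divisions_exact:
  assumes "n \<ge> 1"
  shows "factor_ratio q n * (r_t ^ n - 1) = (1 - fps_const q * fps_X) * r_t ^ (n - 1) - 1"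
    and "fps_X / (r_t ^ n - 1) * (r_t ^ n - 1) = (fps_X :: 'a::field_char_0 fps)"
  unfolding factor_ratio_def
  by (rule fps_X_dvd_divide_r_t[OF assms], simp add: r_t_def fps_power_zeroth)+

lemma fps3_summable_u:
  fixes F :: "nat \<Rightarrow> 'a::field_char_0 fps3"
  assumes "\<And>n. n \<ge> 1 \<Longrightarrow> var_u ^ (n - 1) dvd F n"
  shows "fps3_summable F {1..}"
  unfolding fps3_summable_def
proof (intro allI)
  fix k j m
  have "n \<le> k + 1" if n: "n \<ge> 1" and nz: "F n $ k $ j $ m \<noteq> 0" for n
  proof (rule ccontr)
    assume "\<not> n \<le> k + 1"
    moreover obtain g where "F n = var_u ^ (n - 1) * g" using assms[OF n] by (elim dvdE)
    ultimately show False using nz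
      by (simp add: var_u_def fps_X_power_mult_nth split: if_splits)
  qed
  hence "{n \<in> {1..}. F n $ k $ j $ m \<noteq> 0} \<subseteq> {..k + 1}" by auto
  thus "finite {n \<in> {1..}. F n $ k $ j $ m \<noteq> 0}" by (rule finite_subset) simp
qed

lemma fps3_summable_t:
  fixes F :: "nat \<Rightarrow> 'a::field_char_0 fps3"
  assumes "\<And>n. n \<ge> 1 \<Longrightarrow> var_t ^ n dvd F n"
  shows "fps3_summable F {1..}"
  unfolding fps3_summable_def
proof (intro allI)
  fix k j m
  have "n \<le> m" if n: "n \<ge> 1" and nz: "F n $ k $ j $ m \<noteq> 0" for n
  proof (rule ccontr)
    assume "\<not> n \<le> m"
    moreover obtain g where "F n = var_t ^ n * g" using assms[OF n] by (elim dvdE)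
    ultimately show False using nz by (simp add: var_t_def const_t_def fps_X_power_mult_nth)
  qed
  hence "{n \<in> {1..}. F n $ k $ j $ m \<noteq> 0} \<subseteq> {..m}" by auto
  thus "finite {n \<in> {1..}. F n $ k $ j $ m \<noteq> 0}" by (rule finite_subset) simp
qed

lemma gen_fun_summable: "fps3_summable (gen_fun_term var_t x u v q z) {1..}"
  by (rule fps3_summable_t) (simp add: gen_fun_term_def)

lemma var_u_power_dvd_partial_product: "var_u ^ (n - 1) dvd partial_product v q n"
proof -
  let ?f = "\<lambda>i. var_u * (var_x - r_series ^ i - var_x * const_K v * var_t) *
    const_t (factor_ratio q i) / (var_x - r_series ^ i)"
  have "var_u dvd ?f i" for i
  proof -
    have nz: "(var_x - r_series ^ i :: 'a fps3) $ 0 $ 0 $ 0 \<noteq> 0"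
      by (rule fps3_denominators_nonzero)
    have "var_u dvd ?f i * (var_x - r_series ^ i)"
      unfolding fps3_divide_mult[OF nz] mult.assoc by (rule dvd_triv_left)
    hence "var_u dvd ?f i * (var_x - r_series ^ i) * inverse (var_x - r_series ^ i)"
      by (rule dvd_mult2)
    thus ?thesis by (simp only: mult.assoc fps3_mult_inverse[OF nz] mult_1_right)
  qed
  hence "(\<Prod>i = 1..n - 1. var_u) dvd (\<Prod>i = 1..n - 1. ?f i)" by (intro prod_dvd_prod) auto
  thus ?thesis by (simp add: partial_product_def)
qed

lemma closed_formula_summable:
  "fps3_summable (numerator_term v q) {1..}"
  "fps3_summable (denominator_term v q) {1..}"
  unfolding numerator_term_def denominator_term_def
  by (rule fps3_summable_u, rule dvd_mult, rule var_u_power_dvd_partial_product)+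

end

theory Submission
  imports Defs "HOL-Library.Product_Lexorder"
begin

text \<open>
  The coefficient of \<open>u\<^sup>k\<close> in \<open>u\<^bsup>des \<pi>\<^esup> / (1 - u)\<^sup>n\<close> counts the weakly increasing words \<open>a\<^sub>1, \<dots>, a\<^sub>n = k\<close>
  that increase strictly at the descents of \<open>\<pi>\<close>. Using such a word for the columns and another one,
  attached to the inverse permutation, for the rows, the points \<open>(i, \<pi> i)\<close> are distributed over the
  cells of a grid, and the permutation can be recovered from the number of points in each cell.
  Left-to-right minima become the south-west minimal occupied cells and right-to-left maxima the
  north-east maximal ones, so only the set \<open>S\<close> of occupied cells matters: the coefficient of
  \<open>u\<^sup>k x\<^sup>l\<close> is \<open>\<Sum>\<^sub>S s\<^bsup>|S|\<^esup> q\<^bsup>min S\<^esup> v\<^bsup>max S\<^esup>\<close> with \<open>s = t / (1 - t)\<close>, over the sets \<open>S\<close> in a grid with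
  \<open>k + 1\<close> columns and \<open>l + 1\<close> rows that meet the last column and the last row.

  To compute these sums, put \<open>i\<close> further columns in front of the grid whose cells are occupied freely
  but whose own minima are not counted. Only the set of rows that they occupy matters, each such row
  having weight \<open>r\<^bsup>-i\<^esup> - 1\<close>. Absorbing the first column of the grid into these columns passes from
  \<open>i\<close> to \<open>i + 1\<close>: in the lowest row occupied by either of them, the factor \<open>q\<close> appears exactly if that
  row is empty in the front columns, which produces the factor \<open>((1 - q t) r\<^bsup>i\<^esup> - 1) / (r\<^bsup>i+1\<^esup> - 1)\<close>
  independently of everything else. The exceptional case, in which no row is occupied, leads back to
  \<open>i = 0\<close>. Iterating the resulting linear recursion gives the closed formula. The equidistributions
  come from inversion and from the reverse-complement map.
\<close>

subsection \<open>Words compatible with a permutation\<close>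

text \<open>The pairs \<open>(a i, \<sigma> i)\<close> have to increase lexicographically. For
  injective \<open>\<sigma>\<close> this says that \<open>a\<close> increases weakly, and strictly
  at the descents of \<open>\<sigma>\<close>; the form with arbitrary pairs \<open>i < j\<close>
  allows any two points to be compared directly.\<close>

definition compatible :: "nat \<Rightarrow> (nat \<Rightarrow> nat) \<Rightarrow> (nat \<Rightarrow> nat) \<Rightarrow> bool" where
  "compatible n \<sigma> a \<longleftrightarrow>
     (\<forall>i j. 1 \<le> i \<longrightarrow> i < j \<longrightarrow> j \<le> n \<longrightarrow> a i < a j \<or> (a i = a j \<and> \<sigma> i < \<sigma> j))"

text \<open>Fixing the last and hence largest letter, instead of bounding it, gives the denominator
  \<open>(1 - u) ^ n\<close> and not \<open>(1 - u) ^ (n + 1)\<close>. Extensionality makes a word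
  determined by its letters.\<close>

definition seqs :: "nat \<Rightarrow> (nat \<Rightarrow> nat) \<Rightarrow> nat \<Rightarrow> (nat \<Rightarrow> nat) set" where
  "seqs n \<sigma> k = {a \<in> extensional {1..n}. compatible n \<sigma> a \<and> a n = k}"

text \<open>By transitivity of the lexicographic order, an appended letter need only be compared
  with its predecessor.\<close>

lemma compatible_Suc:
  assumes "n \<ge> 1"
  shows "compatible (Suc n) \<sigma> a \<longleftrightarrow>
     compatible n \<sigma> a \<and> (a n < a (Suc n) \<or> (a n = a (Suc n) \<and> \<sigma> n < \<sigma> (Suc n)))"
    (is "?L \<longleftrightarrow> ?R")
proof
  assume ?L thus ?R using assms unfolding compatible_def by auto
next
  assume R: ?R
  show ?L unfolding compatible_def
  proof (intro allI impI)
    fix i j :: nat assume ij: "1 \<le> i" "i < j" "j \<le> Suc n"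
    show "a i < a j \<or> (a i = a j \<and> \<sigma> i < \<sigma> j)"
    proof (cases "j \<le> n")
      case True thus ?thesis using R ij unfolding compatible_def by blast
    next
      case False
      hence j: "j = Suc n" using ij by simp
      show ?thesis
      proof (cases "i = n")
        case True thus ?thesis using R j by simp
      next
        case False
        hence "a i < a n \<or> (a i = a n \<and> \<sigma> i < \<sigma> n)"
          using R ij j unfolding compatible_def by auto
        thus ?thesis using R j by auto
      qed
    qed
  qed
qed

lemma compatible_cong: "(\<And>i. i \<in> {1..n} \<Longrightarrow> a i = b i) \<Longrightarrow> compatible n \<sigma> a = compatible n \<sigma> b"
  unfolding compatible_def by simp

lemma seqs_Suc:
  assumes "n \<ge> 1"
  shows "seqs (Suc n) \<sigma> k = (\<lambda>a. a(Suc n := k)) `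
    (\<Union>k'\<in>{k'. k' < k \<or> (k' = k \<and> \<sigma> n < \<sigma> (Suc n))}. seqs n \<sigma> k')" (is "_ = ?f ` ?B")
proof
  show "seqs (Suc n) \<sigma> k \<subseteq> ?f ` ?B"
  proof
    fix a assume a: "a \<in> seqs (Suc n) \<sigma> k"
    \<comment> \<open>Resetting the last letter to \<open>undefined\<close> makes the truncated word
      extensional on \<open>{1..n}\<close>.\<close>
    define b where "b = a(Suc n := undefined)"
    have "compatible n \<sigma> a" and c: "a n < a (Suc n) \<or> (a n = a (Suc n) \<and> \<sigma> n < \<sigma> (Suc n))"
      and k: "a (Suc n) = k"
      using a compatible_Suc[OF assms] by (auto simp: seqs_def)
    moreover have "compatible n \<sigma> b = compatible n \<sigma> a"
      by (rule compatible_cong) (auto simp: b_def)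
    moreover have "b \<in> extensional {1..n}" using a
      by (auto simp: b_def seqs_def extensional_def)
    moreover have "b n = a n" by (simp add: b_def)
    ultimately have "b \<in> ?B" by (auto simp: seqs_def)
    moreover have "a = ?f b" using k by (auto simp: b_def)
    ultimately show "a \<in> ?f ` ?B" by blast
  qed
next
  show "?f ` ?B \<subseteq> seqs (Suc n) \<sigma> k"
  proof (rule image_subsetI)
    fix b assume b: "b \<in> ?B"
    have "compatible n \<sigma> (?f b) = compatible n \<sigma> b" by (rule compatible_cong) auto
    thus "?f b \<in> seqs (Suc n) \<sigma> k"
      using b compatible_Suc[OF assms] by (auto simp: seqs_def extensional_def)
  qed
qed

lemma seqs_1: "seqs 1 \<sigma> k = {\<lambda>i. if i = 1 then k else undefined}"
  by (auto simp: seqs_def compatible_def extensional_def fun_eq_iff)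

lemma finite_seqs: "n \<ge> 1 \<Longrightarrow> finite (seqs n \<sigma> k)"
proof (induction n arbitrary: k rule: dec_induct)
  case base
  show ?case unfolding seqs_1 by simp
next
  case (step n)
  have "finite {k'. k' < k \<or> (k' = k \<and> \<sigma> n < \<sigma> (Suc n))}"
    by (rule finite_subset[of _ "{..k}"]) auto
  thus ?case unfolding seqs_Suc[OF step(1)] using step by blast
qed

lemma card_seqs_Suc:
  assumes "n \<ge> 1"
  shows "card (seqs (Suc n) \<sigma> k) =
    (\<Sum>k'\<in>{k'. k' < k \<or> (k' = k \<and> \<sigma> n < \<sigma> (Suc n))}. card (seqs n \<sigma> k'))"
proof -
  let ?K = "{k'. k' < k \<or> (k' = k \<and> \<sigma> n < \<sigma> (Suc n))}"
  have fin: "finite ?K" by (rule finite_subset[of _ "{..k}"]) auto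
  have "inj_on (\<lambda>a. a(Suc n := k)) (\<Union>k'\<in>?K. seqs n \<sigma> k')"
  proof (rule inj_onI)
    fix a b assume a: "a \<in> (\<Union>k'\<in>?K. seqs n \<sigma> k')" and b: "b \<in> (\<Union>k'\<in>?K. seqs n \<sigma> k')"
      and eq: "a(Suc n := k) = b(Suc n := k)"
    have "a (Suc n) = b (Suc n)" using a b by (auto simp: seqs_def extensional_def)
    moreover have "a i = b i" if "i \<noteq> Suc n" for i using fun_cong[OF eq, of i] that by simp
    ultimately show "a = b" by (metis ext)
  qed
  hence "card (seqs (Suc n) \<sigma> k) = card (\<Union>k'\<in>?K. seqs n \<sigma> k')"
    unfolding seqs_Suc[OF assms] by (rule card_image)
  also have "\<dots> = (\<Sum>k'\<in>?K. card (seqs n \<sigma> k'))"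
    by (rule card_UN_disjoint[OF fin]) (auto simp: finite_seqs[OF assms], auto simp: seqs_def)
  finally show ?thesis .
qed

lemma des_Suc:
  assumes "n \<ge> 1"
  shows "des (Suc n) \<sigma> = des n \<sigma> + (if \<sigma> n > \<sigma> (Suc n) then 1 else 0)"
proof -
  have "{i \<in> {1..Suc n - 1}. \<sigma> i > \<sigma> (i + 1)} =
      {i \<in> {1..n - 1}. \<sigma> i > \<sigma> (i + 1)} \<union> (if \<sigma> n > \<sigma> (Suc n) then {n} else {})"
  proof -
    have "{1..Suc n - 1} = insert n {1..n - 1}" using assms by auto
    thus ?thesis by (auto split: if_splits)
  qed
  moreover have "n \<notin> {i \<in> {1..n - 1}. \<sigma> i > \<sigma> (i + 1)}" using assms by auto
  ultimately show ?thesis unfolding des_def by (simp only:) (simp del: One_nat_def)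
qed

text \<open>Multiplication by \<open>1 - fps_X\<close> takes differences in \<open>k\<close>.
  Appending a letter replaces the counts by their partial sums, up to \<open>k\<close> at an ascent
  and strictly below \<open>k\<close> at a descent, so every descent costs one factor
  \<open>fps_X\<close>.\<close>

lemma fps_seqs:
  assumes "n \<ge> 1" and "inj \<sigma>"
  shows "Abs_fps (\<lambda>k. of_nat (card (seqs n \<sigma> k))) * (1 - fps_X) ^ n =
    (fps_X ^ des n \<sigma> :: 'b::comm_ring_1 fps)"
  using assms(1)
proof (induction n rule: dec_induct)
  case base
  have "Abs_fps (\<lambda>k. of_nat (card (seqs 1 \<sigma> k))) * (1 - fps_X) = (1 :: 'b fps)"
    unfolding seqs_1
    by (rule fps_ext) (simp add: right_diff_distrib)
  moreover have "des 1 \<sigma> = 0" by (simp add: des_def)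
  ultimately show ?case by (simp only: power_one_right power_0)
next
  case (step n)
  let ?U = "\<lambda>n. Abs_fps (\<lambda>k. of_nat (card (seqs n \<sigma> k))) :: 'b fps"
  have ne: "\<sigma> n \<noteq> \<sigma> (Suc n)" using assms(2) by (simp add: inj_eq)
  have "?U (Suc n) * (1 - fps_X) = fps_X ^ (if \<sigma> n > \<sigma> (Suc n) then 1 else 0) * ?U n"
  proof (rule fps_ext)
    fix k
    have *: "(?U (Suc n) * (1 - fps_X)) $ k =
        of_nat (card (seqs (Suc n) \<sigma> k)) -
        (if k = 0 then 0 else of_nat (card (seqs (Suc n) \<sigma> (k - 1))))"
      by (simp add: right_diff_distrib)
    show "(?U (Suc n) * (1 - fps_X)) $ k =
        (fps_X ^ (if \<sigma> n > \<sigma> (Suc n) then 1 else 0) * ?U n) $ k"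
    proof (cases "\<sigma> n < \<sigma> (Suc n)")
      case True
      hence "{k'. k' < k \<or> (k' = k \<and> \<sigma> n < \<sigma> (Suc n))} = {..k}" for k :: nat by auto
      hence "card (seqs (Suc n) \<sigma> k) = (\<Sum>k'\<le>k. card (seqs n \<sigma> k'))" for k
        by (simp add: card_seqs_Suc[OF step(1)])
      thus ?thesis unfolding * using True by (cases k) simp_all
    next
      case False
      hence "{k'. k' < k \<or> (k' = k \<and> \<sigma> n < \<sigma> (Suc n))} = {..<k}" for k :: nat by auto
      hence "card (seqs (Suc n) \<sigma> k) = (\<Sum>k'<k. card (seqs n \<sigma> k'))" for k
        by (simp add: card_seqs_Suc[OF step(1)])
      thus ?thesis unfolding * using False ne by (cases k) simp_all
    qed
  qed
  hence "?U (Suc n) * (1 - fps_X) ^ Suc n =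
      fps_X ^ (if \<sigma> n > \<sigma> (Suc n) then 1 else 0) * (?U n * (1 - fps_X) ^ n)"
    unfolding power_Suc by (simp only: mult.assoc[symmetric])
  also have "\<dots> = fps_X ^ des (Suc n) \<sigma>"
    unfolding step.IH des_Suc[OF step(1)] by (simp only: power_add mult.commute)
  finally show ?case .
qed

subsection \<open>Placements of permutations in a grid\<close>

text \<open>The standardization of a word: the only permutation that can arise from the word of rows.\<close>

definition std :: "nat \<Rightarrow> (nat \<Rightarrow> nat) \<Rightarrow> nat \<Rightarrow> nat" where
  "std n c i = (if i \<in> {1..n} then card {j \<in> {1..n}. (c j, j) \<le> (c i, i)} else i)"

text \<open>The set counted for the smaller key is properly contained in the one for the larger key,
  which contains its own index as well.\<close>

lemma std_less_iff:
  assumes "i \<in> {1..n}" "j \<in> {1..n}"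
  shows "std n c i < std n c j \<longleftrightarrow> (c i, i) < (c j, j)"
proof -
  have mono: "std n c i < std n c j"
    if "i \<in> {1..n}" "j \<in> {1..n}" "(c i, i) < (c j, j)" for i j
  proof -
    have "{k \<in> {1..n}. (c k, k) \<le> (c i, i)} \<subset> {k \<in> {1..n}. (c k, k) \<le> (c j, j)}"
    proof (rule psubsetI)
      show "{k \<in> {1..n}. (c k, k) \<le> (c i, i)} \<subseteq> {k \<in> {1..n}. (c k, k) \<le> (c j, j)}"
        using that(3) by (auto intro: order.trans less_imp_le simp del: less_eq_prod_simp less_prod_simp)
      have "j \<in> {k \<in> {1..n}. (c k, k) \<le> (c j, j)}" using that by simp
      moreover have "j \<notin> {k \<in> {1..n}. (c k, k) \<le> (c i, i)}" using that(3) by (auto simp del: less_eq_prod_simp less_prod_simp)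
      ultimately show "{k \<in> {1..n}. (c k, k) \<le> (c i, i)} \<noteq> {k \<in> {1..n}. (c k, k) \<le> (c j, j)}"
        by blast
    qed
    thus ?thesis using that by (simp add: std_def psubset_card_mono del: less_eq_prod_simp less_prod_simp)
  qed
  show ?thesis
  proof (cases "i = j")
    case False
    hence "(c i, i) < (c j, j) \<or> (c j, j) < (c i, i)" by (metis linorder_less_linear prod.inject)
    thus ?thesis using mono assms by (meson order.asym)
  qed simp
qed

lemma std_permutes: "std n c permutes {1..n}"
proof (rule bij_imp_permutes)
  have "std n c i \<in> {1..n}" if "i \<in> {1..n}" for i
  proof -
    have "{i} \<subseteq> {j \<in> {1..n}. (c j, j) \<le> (c i, i)}" using that by auto
    hence "card {i} \<le> card {j \<in> {1..n}. (c j, j) \<le> (c i, i)}" by (intro card_mono) auto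
    moreover have "card {j \<in> {1..n}. (c j, j) \<le> (c i, i)} \<le> card {1..n}"
      by (intro card_mono) auto
    ultimately show ?thesis using that by (simp add: std_def)
  qed
  hence "std n c ` {1..n} \<subseteq> {1..n}" by blast
  moreover have "inj_on (std n c) {1..n}"
  proof (rule inj_onI, rule ccontr)
    fix i j assume "i \<in> {1..n}" "j \<in> {1..n}" "std n c i = std n c j" "i \<noteq> j"
    thus False using std_less_iff[of i n j c] std_less_iff[of j n i c]
      by (metis linorder_less_linear order.irrefl prod.inject)
  qed
  ultimately show "bij_betw (std n c) {1..n} {1..n}"
    by (simp add: bij_betw_def endo_inj_surj)
next
  fix i assume "i \<notin> {1..n}"
  thus "std n c i = i" by (auto simp: std_def)
qed

text \<open>The value \<open>\<pi> i\<close> is the number of values up to it, so a permutation of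
  \<open>{1..n}\<close> is determined by the order of its values.\<close>

lemma std_unique:
  assumes "\<pi> permutes {1..n}"
    and "\<And>i j. i \<in> {1..n} \<Longrightarrow> j \<in> {1..n} \<Longrightarrow> \<pi> i < \<pi> j \<longleftrightarrow> (c i, i) < (c j, j)"
  shows "\<pi> = std n c"
proof
  fix i
  show "\<pi> i = std n c i"
  proof (cases "i \<in> {1..n}")
    case True
    have "\<pi> i \<in> {1..n}" using permutes_in_image[OF assms(1)] True by simp
    have "{j \<in> {1..n}. (c j, j) \<le> (c i, i)} = {j \<in> {1..n}. \<pi> j \<le> \<pi> i}"
      (is "Collect ?P = Collect ?Q")
    proof (rule Collect_cong)
      fix j show "?P j \<longleftrightarrow> ?Q j"
        using assms(2)[of i j] True by (simp add: linorder_not_less[symmetric] cong: conj_cong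
          del: less_prod_simp less_eq_prod_simp)
    qed
    also have "\<pi> ` \<dots> = {1..\<pi> i}"
    proof
      show "\<pi> ` {j \<in> {1..n}. \<pi> j \<le> \<pi> i} \<subseteq> {1..\<pi> i}"
      proof (rule image_subsetI)
        fix j assume "j \<in> {j \<in> {1..n}. \<pi> j \<le> \<pi> i}"
        thus "\<pi> j \<in> {1..\<pi> i}" using permutes_in_image[OF assms(1), of j] by simp
      qed
      show "{1..\<pi> i} \<subseteq> \<pi> ` {j \<in> {1..n}. \<pi> j \<le> \<pi> i}"
      proof
        fix m assume m: "m \<in> {1..\<pi> i}"
        hence "m \<in> {1..n}" using \<open>\<pi> i \<in> {1..n}\<close> by auto
        then obtain j where "j \<in> {1..n}" "m = \<pi> j" using permutes_image[OF assms(1)] by blast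
        thus "m \<in> \<pi> ` {j \<in> {1..n}. \<pi> j \<le> \<pi> i}" using m by auto
      qed
    qed
    finally have image: "\<pi> ` {j \<in> {1..n}. (c j, j) \<le> (c i, i)} = {1..\<pi> i}" .
    have "inj_on \<pi> {j \<in> {1..n}. (c j, j) \<le> (c i, i)}"
      using permutes_inj[OF assms(1)] by (rule inj_on_subset) simp
    from card_image[OF this]
    have "card {j \<in> {1..n}. (c j, j) \<le> (c i, i)} = card {1..\<pi> i}"
      unfolding image by (rule sym)
    thus ?thesis unfolding std_def using True by (simp del: less_eq_prod_simp)
  next
    case False thus ?thesis using permutes_not_in[OF assms(1)] by (auto simp: std_def)
  qed
qed

text \<open>A placement \<open>(\<pi>, a, b)\<close> puts the point \<open>(i, \<pi> i)\<close> into the cell in column \<open>a i\<close> and row \<open>b (\<pi> i)\<close>.\<close>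

definition placements :: "nat \<Rightarrow> nat \<Rightarrow> nat \<Rightarrow> ((nat \<Rightarrow> nat) \<times> (nat \<Rightarrow> nat) \<times> (nat \<Rightarrow> nat)) set" where
  "placements n k l = (SIGMA \<pi>:perms n. seqs n \<pi> k \<times> seqs n (inv \<pi>) l)"

text \<open>Since this list turns out to be sorted, it carries the same information as the number of
  points in each cell.\<close>

definition cell_word ::
  "nat \<Rightarrow> (nat \<Rightarrow> nat) \<times> (nat \<Rightarrow> nat) \<times> (nat \<Rightarrow> nat) \<Rightarrow> (nat \<times> nat) list" where
  "cell_word n = (\<lambda>(\<pi>, a, b). map (\<lambda>i. (a i, b (\<pi> i))) [1..<Suc n])"

text \<open>The occupied last column and last row reflect that the two words end exactly in
  \<open>k\<close> and \<open>l\<close>.\<close>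

definition boxed_sets :: "nat \<Rightarrow> nat \<Rightarrow> (nat \<times> nat) set set" where
  "boxed_sets k l = {S. S \<subseteq> {..k} \<times> {..l} \<and> k \<in> fst ` S \<and> l \<in> snd ` S}"

text \<open>Minimality refers to the componentwise order, whereas \<open>\<le>\<close> on pairs is
  the lexicographic order by which cell words are sorted.\<close>

definition sw_min :: "(nat \<times> nat) set \<Rightarrow> (nat \<times> nat) set" where
  "sw_min S = {p \<in> S. \<forall>p'\<in>S. fst p' \<le> fst p \<and> snd p' \<le> snd p \<longrightarrow> p' = p}"

definition ne_max :: "(nat \<times> nat) set \<Rightarrow> (nat \<times> nat) set" where
  "ne_max S = {p \<in> S. \<forall>p'\<in>S. fst p \<le> fst p' \<and> snd p \<le> snd p' \<longrightarrow> p' = p}"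

text \<open>Compatibility of \<open>b\<close> with \<open>inv \<pi>\<close>, read at the values
  \<open>\<pi> i\<close> and \<open>\<pi> j\<close>, orders the keys \<open>(b (\<pi> i), i)\<close>
  like the values; totality turns the implication into an equivalence. This is the hypothesis of
  \<open>std_unique\<close>.\<close>

lemma placements_order:
  assumes "(\<pi>, a, b) \<in> placements n k l" "i \<in> {1..n}" "j \<in> {1..n}"
  shows "\<pi> i < \<pi> j \<longleftrightarrow> (b (\<pi> i), i) < (b (\<pi> j), j)"
    and "i < j \<Longrightarrow> a i < a j \<or> (a i = a j \<and> \<pi> i < \<pi> j)"
proof -
  have \<pi>: "\<pi> permutes {1..n}" and a: "compatible n \<pi> a" and b: "compatible n (inv \<pi>) b"
    using assms(1) by (auto simp: placements_def perms_def seqs_def)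
  show "i < j \<Longrightarrow> a i < a j \<or> (a i = a j \<and> \<pi> i < \<pi> j)"
    using a assms(2,3) by (auto simp: compatible_def)
  have inv: "inv \<pi> (\<pi> i) = i" for i using permutes_inverses(2)[OF \<pi>] .
  have imp: "(b (\<pi> i), i) < (b (\<pi> j), j)"
    if "\<pi> i < \<pi> j" "i \<in> {1..n}" "j \<in> {1..n}" for i j
  proof -
    have "1 \<le> \<pi> i" "\<pi> j \<le> n" using that permutes_in_image[OF \<pi>] by auto
    hence "b (\<pi> i) < b (\<pi> j) \<or> (b (\<pi> i) = b (\<pi> j) \<and> inv \<pi> (\<pi> i) < inv \<pi> (\<pi> j))"
      using b that(1) unfolding compatible_def by blast
    thus ?thesis by (auto simp: inv)
  qed
  show "\<pi> i < \<pi> j \<longleftrightarrow> (b (\<pi> i), i) < (b (\<pi> j), j)"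
    using imp[of i j] imp[of j i] assms(2,3) permutes_inj[OF \<pi>]
    by (metis injD linorder_less_linear order.asym)
qed

lemma sorted_cell_word:
  assumes "(\<pi>, a, b) \<in> placements n k l"
  shows "sorted (cell_word n (\<pi>, a, b))"
  unfolding cell_word_def prod.case sorted_wrt_iff_nth_less
proof (intro allI impI)
  let ?w = "map (\<lambda>i. (a i, b (\<pi> i))) [1..<Suc n]"
  fix i j assume "i < j" "j < length ?w"
  hence "Suc i \<in> {1..n}" "Suc j \<in> {1..n}" "Suc i < Suc j" by (auto simp del: upt_Suc)
  from placements_order(1)[OF assms this(1,2)] placements_order(2)[OF assms this]
  show "?w ! i \<le> ?w ! j"
    using \<open>i < j\<close> \<open>j < _\<close> by (auto simp del: upt_Suc)
qed

lemma set_cell_word: "set (cell_word n (\<pi>, a, b)) = (\<lambda>i. (a i, b (\<pi> i))) ` {1..n}"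
  by (simp add: cell_word_def atLeastLessThanSuc_atLeastAtMost del: upt_Suc)

lemma cell_word_nth:
  "i \<in> {1..n} \<Longrightarrow> cell_word n (\<pi>, a, b) ! (i - 1) = (a i, b (\<pi> i))"
  by (auto simp: cell_word_def simp del: upt_Suc)

text \<open>The list shows the column and the row of each point. Its rows determine
  \<open>\<pi>\<close> by standardization, and then \<open>a\<close> and \<open>b\<close> can be
  read off.\<close>

lemma inj_on_cell_word: "inj_on (cell_word n) (placements n k l)"
proof (rule inj_onI)
  fix x y
  assume xy: "x \<in> placements n k l" "y \<in> placements n k l" "cell_word n x = cell_word n y"
  obtain \<pi> a b where x: "x = (\<pi>, a, b)" by (cases x)
  obtain \<pi>' a' b' where y: "y = (\<pi>', a', b')" by (cases y)
  have P: "(\<pi>, a, b) \<in> placements n k l" and P': "(\<pi>', a', b') \<in> placements n k l"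
    and eq: "cell_word n (\<pi>, a, b) = cell_word n (\<pi>', a', b')"
    using xy unfolding x y by blast+
  have \<pi>: "\<pi> permutes {1..n}" and \<pi>': "\<pi>' permutes {1..n}"
    and ext: "a \<in> extensional {1..n}" "b \<in> extensional {1..n}"
      "a' \<in> extensional {1..n}" "b' \<in> extensional {1..n}"
    using P P' by (auto simp: placements_def perms_def seqs_def)
  have nth: "a i = a' i \<and> b (\<pi> i) = b' (\<pi>' i)" if "i \<in> {1..n}" for i
    using arg_cong[OF eq, of "\<lambda>xs. xs ! (i - 1)"] that by (simp only: cell_word_nth prod.inject)
  have "\<pi> = std n (\<lambda>i. b (\<pi> i))"
    by (rule std_unique[OF \<pi>]) (rule placements_order(1)[OF P])
  also have "\<dots> = \<pi>'"
    by (rule std_unique[OF \<pi>', symmetric]) (simp only: placements_order(1)[OF P'] nth)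
  finally have "\<pi> = \<pi>'" .
  moreover have "a = a'" using nth by (intro extensionalityI[OF ext(1,3)]) simp
  moreover have "b = b'"
  proof (rule extensionalityI[OF ext(2,4)])
    fix j assume "j \<in> {1..n}"
    then obtain i where "i \<in> {1..n}" "j = \<pi> i" using permutes_image[OF \<pi>] by blast
    thus "b j = b' j" using nth \<open>\<pi> = \<pi>'\<close> by simp
  qed
  ultimately show "x = y" unfolding x y by blast
qed

lemma compatible_le_last:
  assumes "compatible n \<sigma> a" "i \<in> {1..n}"
  shows "a i \<le> a n"
proof (cases "i = n")
  case False
  hence "1 \<le> i" "i < n" using assms(2) by auto
  thus ?thesis using assms(1) unfolding compatible_def by (metis less_imp_le order.refl)
qed simp

lemma cell_word_mem:
  assumes "(\<pi>, a, b) \<in> placements n k l" and "n \<ge> 1"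
  shows "set (cell_word n (\<pi>, a, b)) \<in> boxed_sets k l"
proof -
  have \<pi>: "\<pi> permutes {1..n}" and a: "a n = k" and b: "b n = l"
    and comp: "compatible n \<pi> a" "compatible n (inv \<pi>) b"
    using assms(1) by (auto simp: placements_def perms_def seqs_def)
  have "a i \<le> k" if "i \<in> {1..n}" for i
    using compatible_le_last[OF comp(1) that] a by simp
  moreover have b_le: "b j \<le> l" if "j \<in> {1..n}" for j
    using compatible_le_last[OF comp(2) that] b by simp
  moreover have "b (\<pi> i) \<le> l" if "i \<in> {1..n}" for i
    using b_le permutes_in_image[OF \<pi>] that by blast
  moreover have "k \<in> fst ` set (cell_word n (\<pi>, a, b))"
    unfolding set_cell_word image_image using a assms(2) by (auto intro!: image_eqI[of _ _ n])
  moreover have "l \<in> snd ` set (cell_word n (\<pi>, a, b))"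
  proof -
    have "n \<in> \<pi> ` {1..n}" using permutes_image[OF \<pi>] assms(2) by simp
    then obtain i where "i \<in> {1..n}" "\<pi> i = n" by force
    thus ?thesis unfolding set_cell_word image_image using b by (auto intro!: image_eqI[of _ _ i])
  qed
  ultimately show ?thesis unfolding boxed_sets_def set_cell_word by blast
qed

text \<open>The inverse construction standardizes the rows of the list to a permutation, takes its
  columns as \<open>a\<close> and carries its rows over from positions to values to obtain
  \<open>b\<close>.\<close>

lemma cell_word_surj:
  assumes "n \<ge> 1" "sorted xs" "length xs = n" "set xs \<in> boxed_sets k l"
  shows "xs \<in> cell_word n ` placements n k l"
proof -
  define c where "c i = snd (xs ! (i - 1))" for i
  define \<pi> where "\<pi> = std n c"
  define a where "a = restrict (\<lambda>i. fst (xs ! (i - 1))) {1..n}"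
  define b where "b = restrict (\<lambda>j. c (inv \<pi> j)) {1..n}"
  have \<pi>: "\<pi> permutes {1..n}" unfolding \<pi>_def by (rule std_permutes)
  have less: "\<pi> i < \<pi> j \<longleftrightarrow> (c i, i) < (c j, j)" if "i \<in> {1..n}" "j \<in> {1..n}" for i j
    unfolding \<pi>_def using that by (rule std_less_iff)
  have b\<pi>: "b (\<pi> i) = c i" if "i \<in> {1..n}" for i
    using that permutes_in_image[OF \<pi>] permutes_inverses(2)[OF \<pi>] by (simp add: b_def)
  have word: "cell_word n (\<pi>, a, b) = xs"
    unfolding cell_word_def prod.case
    by (rule nth_equalityI) (use assms(3) in \<open>auto simp: a_def b\<pi> c_def simp del: upt_Suc\<close>)
  have xs_mem: "xs ! (i - 1) \<in> set xs" if "i \<in> {1..n}" for i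
    using that assms(3) by (intro nth_mem) auto
  have box: "set xs \<subseteq> {..k} \<times> {..l}" "k \<in> fst ` set xs" "l \<in> snd ` set xs"
    using assms(4) by (auto simp: boxed_sets_def)
  have comp_a: "compatible n \<pi> a"
    unfolding compatible_def
  proof (intro allI impI)
    fix i j assume ij: "1 \<le> i" "i < j" "j \<le> n"
    have "xs ! (i - 1) \<le> xs ! (j - 1)"
      using ij assms(2,3) by (intro sorted_nth_mono) auto
    \<comment> \<open>Within a column the rows increase only weakly; \<open>std\<close> ranks equal
      rows by position, so \<open>\<pi>\<close> still increases.\<close>
    hence "a i < a j \<or> (a i = a j \<and> c i \<le> c j)"
      using ij by (auto simp: a_def c_def less_eq_prod_def)
    thus "a i < a j \<or> (a i = a j \<and> \<pi> i < \<pi> j)" using less[of i j] ij by auto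
  qed
  have comp_b: "compatible n (inv \<pi>) b"
    unfolding compatible_def
  proof (intro allI impI)
    fix i j assume ij: "1 \<le> i" "i < j" "j \<le> n"
    have mem: "i \<in> {1..n}" "j \<in> {1..n}" using ij by auto
    have inv: "inv \<pi> i \<in> {1..n}" "inv \<pi> j \<in> {1..n}"
      using mem permutes_in_image[OF permutes_inv[OF \<pi>]] by blast+
    have "(c (inv \<pi> i), inv \<pi> i) < (c (inv \<pi> j), inv \<pi> j)"
      using less[OF inv] ij(2) by (simp only: permutes_inverses(1)[OF \<pi>])
    thus "b i < b j \<or> (b i = b j \<and> inv \<pi> i < inv \<pi> j)" using mem by (auto simp: b_def)
  qed
  have "a n = k"
  proof -
    obtain p where "p \<in> set xs" "fst p = k" using box(2) by auto
    then obtain i where i: "i < n" "fst (xs ! i) = k" using assms(3) by (auto simp: in_set_conv_nth)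
    have "a (Suc i) \<le> a n" using compatible_le_last[OF comp_a] i(1) by simp
    moreover have "a n \<le> k" using xs_mem[of n] box(1) assms(1) by (auto simp: a_def)
    ultimately show ?thesis using i by (auto simp: a_def)
  qed
  moreover have "b n = l"
  proof -
    obtain p where "p \<in> set xs" "snd p = l" using box(3) by auto
    then obtain i0 where i0: "i0 < n" "snd (xs ! i0) = l" using assms(3) by (auto simp: in_set_conv_nth)
    define i where "i = Suc i0"
    have i: "i \<in> {1..n}" "c i = l" using i0 by (auto simp: i_def c_def)
    have \<pi>i: "\<pi> i \<in> {1..n}" using i permutes_in_image[OF \<pi>] by blast
    have "b (\<pi> i) \<le> b n" using compatible_le_last[OF comp_b \<pi>i] .
    moreover have "b n \<le> l"
    proof -
      have "inv \<pi> n \<in> {1..n}"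
        using assms(1) permutes_in_image[OF permutes_inv[OF \<pi>], of n] by simp
      from xs_mem[OF this] show ?thesis using box(1) assms(1) by (auto simp: b_def c_def)
    qed
    ultimately show ?thesis using b\<pi>[OF i(1)] i(2) by simp
  qed
  moreover have "a \<in> extensional {1..n}" "b \<in> extensional {1..n}" by (auto simp: a_def b_def)
  ultimately have "(\<pi>, a, b) \<in> placements n k l"
    using \<pi> comp_a comp_b by (simp add: placements_def perms_def seqs_def)
  thus ?thesis using word by force
qed

lemma bij_betw_cell_word:
  assumes "n \<ge> 1"
  shows "bij_betw (cell_word n) (placements n k l)
    {xs. sorted xs \<and> length xs = n \<and> set xs \<in> boxed_sets k l}"
  unfolding bij_betw_def
proof (intro conjI inj_on_cell_word subset_antisym subsetI)
  fix xs assume "xs \<in> cell_word n ` placements n k l"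
  then obtain \<pi> a b where "(\<pi>, a, b) \<in> placements n k l" "xs = cell_word n (\<pi>, a, b)" by auto
  thus "xs \<in> {xs. sorted xs \<and> length xs = n \<and> set xs \<in> boxed_sets k l}"
    using sorted_cell_word cell_word_mem[OF _ assms] by (simp add: cell_word_def)
next
  fix xs assume "xs \<in> {xs. sorted xs \<and> length xs = n \<and> set xs \<in> boxed_sets k l}"
  thus "xs \<in> cell_word n ` placements n k l" using cell_word_surj[OF assms] by simp
qed

section \<open>Records of a permutation as extremal cells\<close>

text \<open>The points of one cell increase from left to right, so only the first of them can be a
  left-to-right minimum, and it is one exactly if no other occupied cell lies weakly
  south-west.\<close>

lemma lmin_placement:
  assumes P: "(\<pi>, a, b) \<in> placements n k l"
  shows "lmin n \<pi> = card (sw_min (set (cell_word n (\<pi>, a, b))))"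
proof -
  define c where "c i = b (\<pi> i)" for i
  define p where "p i = (a i, c i)" for i
  define I where "I = {i \<in> {1..n}. \<forall>j\<in>{1..n}. j < i \<longrightarrow> \<pi> i < \<pi> j}"
  have \<pi>: "inj \<pi>" using P permutes_inj by (auto simp: placements_def perms_def)
  have col: "a i < a j \<or> (a i = a j \<and> \<pi> i < \<pi> j)" if "i \<in> {1..n}" "j \<in> {1..n}" "i < j" for i j
    using placements_order(2)[OF P that] .
  have row: "c i \<le> c j \<and> (i < j \<or> c i < c j)" if "i \<in> {1..n}" "j \<in> {1..n}" "\<pi> i < \<pi> j" for i j
    using placements_order(1)[OF P that(1,2)] that(3) by (auto simp: c_def)
  have S: "set (cell_word n (\<pi>, a, b)) = p ` {1..n}" by (simp add: set_cell_word p_def c_def)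
  have "bij_betw p I (sw_min (p ` {1..n}))"
    unfolding bij_betw_def
  proof (intro conjI subset_antisym)
    show "inj_on p I"
    proof (rule linorder_inj_onI)
      fix i j assume "i < j" "i \<in> I" "j \<in> I"
      thus "p i \<noteq> p j" using col[of i j] by (fastforce simp: I_def p_def)
    qed auto
    show "p ` I \<subseteq> sw_min (p ` {1..n})"
    proof (rule image_subsetI)
      fix i assume i: "i \<in> I"
      have "p j = p i" if j: "j \<in> {1..n}" and le: "a j \<le> a i" "c j \<le> c i" for j
      proof (cases i j rule: linorder_cases)
        case less
        thus ?thesis using col[of i j] row[of i j] i j le by (auto simp: I_def p_def)
      next
        case greater
        thus ?thesis using row[of i j] i j le by (auto simp: I_def p_def)
      qed simp
      thus "p i \<in> sw_min (p ` {1..n})" using i by (auto simp: sw_min_def p_def I_def)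
    qed
    show "sw_min (p ` {1..n}) \<subseteq> p ` I"
    proof
      fix s assume s: "s \<in> sw_min (p ` {1..n})"
      define J where "J = {i \<in> {1..n}. p i = s}"
      have J: "finite J" "J \<noteq> {}" using s by (auto simp: J_def sw_min_def)
      \<comment> \<open>The leftmost point of the cell: an earlier and lower point would lie in a
        cell weakly south-west, hence in the same cell by minimality, contradicting this
        choice.\<close>
      define i where "i = Min J"
      have i: "i \<in> {1..n}" "p i = s" using Min_in[OF J] by (auto simp: i_def J_def)
      have "\<pi> i < \<pi> j" if j: "j \<in> {1..n}" "j < i" for j
      proof (rule ccontr)
        assume "\<not> \<pi> i < \<pi> j"
        moreover have "\<pi> i \<noteq> \<pi> j" using \<pi> j(2) by (simp add: inj_eq)
        ultimately have "\<pi> j < \<pi> i" by simp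
        with row[OF j(1) i(1)] have "c j \<le> c i" by blast
        moreover have "a j \<le> a i" using col[OF j(1) i(1) j(2)] by linarith
        moreover have "p j \<in> p ` {1..n}" using j(1) by blast
        ultimately have "p j = s" using s i(2) unfolding sw_min_def by (force simp: p_def)
        hence "j \<in> J" using j(1) by (simp add: J_def)
        thus False using Min_le[OF J(1), of j] j(2) by (simp add: i_def)
      qed
      thus "s \<in> p ` I" using i by (auto simp: I_def)
    qed
  qed
  hence "card (sw_min (p ` {1..n})) = card I" by (simp add: bij_betw_same_card)
  also have "\<dots> = card (\<pi> ` I)" by (rule card_image[symmetric]) (rule inj_on_subset[OF \<pi>], simp)
  also have "\<pi> ` I = {\<pi> i | i. i \<in> {1..n} \<and> (\<forall>j \<in> {1..n}. j < i \<longrightarrow> \<pi> i < \<pi> j)}"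
    by (auto simp: I_def)
  finally show ?thesis unfolding lmin_def S by simp
qed

text \<open>The argument for left-to-right minima after a half turn; the last point of the cell
  replaces the first.\<close>

lemma rmax_placement:
  assumes P: "(\<pi>, a, b) \<in> placements n k l"
  shows "rmax n \<pi> = card (ne_max (set (cell_word n (\<pi>, a, b))))"
proof -
  define c where "c i = b (\<pi> i)" for i
  define p where "p i = (a i, c i)" for i
  define I where "I = {i \<in> {1..n}. \<forall>j\<in>{1..n}. j > i \<longrightarrow> \<pi> i > \<pi> j}"
  have \<pi>: "inj \<pi>" using P permutes_inj by (auto simp: placements_def perms_def)
  have col: "a i < a j \<or> (a i = a j \<and> \<pi> i < \<pi> j)" if "i \<in> {1..n}" "j \<in> {1..n}" "i < j" for i j
    using placements_order(2)[OF P that] .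
  have row: "c i \<le> c j \<and> (i < j \<or> c i < c j)" if "i \<in> {1..n}" "j \<in> {1..n}" "\<pi> i < \<pi> j" for i j
    using placements_order(1)[OF P that(1,2)] that(3) by (auto simp: c_def)
  have S: "set (cell_word n (\<pi>, a, b)) = p ` {1..n}" by (simp add: set_cell_word p_def c_def)
  have "bij_betw p I (ne_max (p ` {1..n}))"
    unfolding bij_betw_def
  proof (intro conjI subset_antisym)
    show "inj_on p I"
    proof (rule linorder_inj_onI)
      fix i j assume "i < j" "i \<in> I" "j \<in> I"
      thus "p i \<noteq> p j" using col[of i j] by (fastforce simp: I_def p_def)
    qed auto
    show "p ` I \<subseteq> ne_max (p ` {1..n})"
    proof (rule image_subsetI)
      fix i assume i: "i \<in> I"
      have "p j = p i" if j: "j \<in> {1..n}" and le: "a i \<le> a j" "c i \<le> c j" for j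
      proof (cases i j rule: linorder_cases)
        case greater
        thus ?thesis using col[of j i] row[of j i] i j le by (auto simp: I_def p_def)
      next
        case less
        thus ?thesis using row[of j i] i j le by (auto simp: I_def p_def)
      qed simp
      thus "p i \<in> ne_max (p ` {1..n})" using i by (auto simp: ne_max_def p_def I_def)
    qed
    show "ne_max (p ` {1..n}) \<subseteq> p ` I"
    proof
      fix s assume s: "s \<in> ne_max (p ` {1..n})"
      define J where "J = {i \<in> {1..n}. p i = s}"
      have J: "finite J" "J \<noteq> {}" using s by (auto simp: J_def ne_max_def)
      define i where "i = Max J"
      have i: "i \<in> {1..n}" "p i = s" using Max_in[OF J] by (auto simp: i_def J_def)
      have "\<pi> i > \<pi> j" if j: "j \<in> {1..n}" "j > i" for j
      proof (rule ccontr)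
        assume "\<not> \<pi> i > \<pi> j"
        moreover have "\<pi> i \<noteq> \<pi> j" using \<pi> j(2) by (simp add: inj_eq)
        ultimately have "\<pi> i < \<pi> j" by simp
        with row[OF i(1) j(1)] have "c i \<le> c j" by blast
        moreover have "a i \<le> a j" using col[OF i(1) j(1) j(2)] by linarith
        moreover have "p j \<in> p ` {1..n}" using j(1) by blast
        ultimately have "p j = s" using s i(2) unfolding ne_max_def by (force simp: p_def)
        hence "j \<in> J" using j(1) by (simp add: J_def)
        thus False using Max_ge[OF J(1), of j] j(2) by (simp add: i_def)
      qed
      thus "s \<in> p ` I" using i by (auto simp: I_def)
    qed
  qed
  hence "card (ne_max (p ` {1..n})) = card I" by (simp add: bij_betw_same_card)
  also have "\<dots> = card (\<pi> ` I)" by (rule card_image[symmetric]) (rule inj_on_subset[OF \<pi>], simp)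
  also have "\<pi> ` I = {\<pi> i | i. i \<in> {1..n} \<and> (\<forall>j \<in> {1..n}. j > i \<longrightarrow> \<pi> i > \<pi> j)}"
    by (auto simp: I_def)
  finally show ?thesis unfolding rmax_def S by simp
qed

section \<open>Words with a prescribed set of cells\<close>

definition sorted_lists :: "'c::linorder set \<Rightarrow> nat \<Rightarrow> 'c list set" where
  "sorted_lists S m = {xs. sorted xs \<and> length xs = m \<and> set xs = S}"

lemma finite_sorted_lists: "finite S \<Longrightarrow> finite (sorted_lists S m)"
  by (rule finite_subset[OF _ finite_lists_length_eq[of S m]]) (auto simp: sorted_lists_def)

text \<open>This is \<open>t / (1 - t)\<close>, the series counting the points of a nonempty
  cell.\<close>

definition s_t :: "'a::field_char_0 fps" where "s_t = fps_X * inverse r_t"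

lemma r_t_inverse: "inverse r_t * r_t = (1 :: 'a::field_char_0 fps)"
  by (rule inverse_mult_eq_1) (simp add: r_t_def)

text \<open>Removing the first letter, which is the least element \<open>b\<close>, leaves a sorted
  list in which \<open>b\<close> still occurs or one with letter set \<open>A\<close>. Solving the
  resulting linear equation for the series of \<open>insert b A\<close> gives one factor
  \<open>s_t\<close> per element.\<close>

lemma fps_sorted_lists:
  fixes S :: "'c::linorder set"
  assumes "finite S"
  shows "Abs_fps (\<lambda>m. of_nat (card (sorted_lists S m))) = (s_t ^ card S :: 'a::field_char_0 fps)"
  using assms
proof (induction S rule: finite_linorder_min_induct)
  case empty
  have "sorted_lists ({} :: 'c set) m = (if m = 0 then {[]} else {})" for m
    by (auto simp: sorted_lists_def)
  thus ?case by (auto simp: fps_eq_iff)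
next
  case (insert b A)
  let ?P = "\<lambda>S :: 'c set. Abs_fps (\<lambda>m. of_nat (card (sorted_lists S m))) :: 'a fps"
  let ?B = "insert b A"
  have bA: "b \<notin> A" using insert(2) by auto
  have Suc: "sorted_lists ?B (Suc m) = (#) b ` (sorted_lists ?B m \<union> sorted_lists A m)" for m
  proof (intro subset_antisym subsetI)
    fix ys assume ys: "ys \<in> sorted_lists ?B (Suc m)"
    then obtain x xs where x: "ys = x # xs" by (cases ys) (auto simp: sorted_lists_def)
    have "x \<in> ?B" "\<forall>z\<in>?B. x \<le> z" using ys by (auto simp: x sorted_lists_def)
    hence "x = b" using insert(2) by force
    moreover have "sorted xs" "length xs = m" "set xs = ?B \<or> set xs = A"
      using ys bA by (auto simp: x \<open>x = b\<close> sorted_lists_def)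
    ultimately show "ys \<in> (#) b ` (sorted_lists ?B m \<union> sorted_lists A m)"
      by (auto simp: x sorted_lists_def)
  next
    fix ys assume "ys \<in> (#) b ` (sorted_lists ?B m \<union> sorted_lists A m)"
    thus "ys \<in> sorted_lists ?B (Suc m)"
      using insert(2) by (auto simp: sorted_lists_def less_imp_le)
  qed
  have card: "card (sorted_lists ?B (Suc m)) = card (sorted_lists ?B m) + card (sorted_lists A m)"
    for m
  proof -
    have "card (sorted_lists ?B (Suc m)) = card (sorted_lists ?B m \<union> sorted_lists A m)"
      unfolding Suc by (rule card_image) simp
    also have "\<dots> = card (sorted_lists ?B m) + card (sorted_lists A m)"
      using bA insert(1)
      by (intro card_Un_disjoint finite_sorted_lists) (auto simp: sorted_lists_def)
    finally show ?thesis .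
  qed
  have "?P ?B = fps_X * (?P ?B + ?P A)"
  proof (rule fps_ext)
    fix m
    show "?P ?B $ m = (fps_X * (?P ?B + ?P A)) $ m"
    proof (cases m)
      case 0
      have "sorted_lists ?B 0 = {}" by (auto simp: sorted_lists_def)
      thus ?thesis using 0 by simp
    qed (simp add: card)
  qed
  hence times_r: "?P ?B * r_t = fps_X * ?P A" by (simp add: r_t_def algebra_simps)
  have "?P ?B = ?P ?B * r_t * inverse r_t"
    by (simp only: mult.assoc mult.commute[of r_t] r_t_inverse mult_1_right)
  also have "\<dots> = s_t * ?P A" unfolding times_r s_t_def by (simp only: ac_simps)
  finally have "?P ?B = s_t * ?P A" .
  thus ?case using insert bA by simp
qed

definition cell_weight :: "'a \<Rightarrow> 'a \<Rightarrow> (nat \<times> nat) set \<Rightarrow> 'a::field_char_0" where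
  "cell_weight v q S = q ^ card (sw_min S) * v ^ card (ne_max S)"

lemma finite_boxed_sets: "finite (boxed_sets k l)"
  by (rule finite_subset[of _ "Pow ({..k} \<times> {..l})"]) (auto simp: boxed_sets_def)

lemma finite_boxed_set: "S \<in> boxed_sets k l \<Longrightarrow> finite S"
  by (rule finite_subset[of _ "{..k} \<times> {..l}"]) (auto simp: boxed_sets_def)

text \<open>Both record numbers depend only on the set of occupied cells, so the sum over placements
  is transported to sorted lists and grouped by this set.\<close>

lemma sum_perms_boxed:
  fixes v q :: "'a::field_char_0"
  assumes "n \<ge> 1"
  shows "(\<Sum>\<pi>\<in>perms n. q ^ lmin n \<pi> * v ^ rmax n \<pi> *
      (of_nat (card (seqs n \<pi> k)) * of_nat (card (seqs n (inv \<pi>) l)))) =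
    (\<Sum>S\<in>boxed_sets k l. fps_const (cell_weight v q S) * s_t ^ card S) $ n"
proof -
  have fin: "finite (perms n)" by (simp add: perms_def finite_permutations)
  have "(\<Sum>\<pi>\<in>perms n. q ^ lmin n \<pi> * v ^ rmax n \<pi> *
      (of_nat (card (seqs n \<pi> k)) * of_nat (card (seqs n (inv \<pi>) l)))) =
    (\<Sum>\<pi>\<in>perms n. \<Sum>ab\<in>seqs n \<pi> k \<times> seqs n (inv \<pi>) l. q ^ lmin n \<pi> * v ^ rmax n \<pi>)"
    by (intro sum.cong refl) (simp add: card_cartesian_product mult.commute)
  also have "\<dots> = (\<Sum>(\<pi>, ab)\<in>placements n k l. q ^ lmin n \<pi> * v ^ rmax n \<pi>)"
    unfolding placements_def
    by (rule sum.Sigma) (use fin finite_seqs[OF assms] in auto)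
  also have "\<dots> = (\<Sum>x\<in>placements n k l. cell_weight v q (set (cell_word n x)))"
    by (rule sum.cong) (auto simp: cell_weight_def lmin_placement rmax_placement)
  also have "\<dots> = (\<Sum>xs\<in>{xs. sorted xs \<and> length xs = n \<and> set xs \<in> boxed_sets k l}.
      cell_weight v q (set xs))"
    by (rule sum.reindex_bij_betw[OF bij_betw_cell_word[OF assms]])
  also have "{xs. sorted xs \<and> length xs = n \<and> set xs \<in> boxed_sets k l} =
      (\<Union>S\<in>boxed_sets k l. sorted_lists S n)" by (auto simp: sorted_lists_def)
  also have "(\<Sum>xs\<in>\<dots>. cell_weight v q (set xs)) =
      (\<Sum>S\<in>boxed_sets k l. \<Sum>xs\<in>sorted_lists S n. cell_weight v q (set xs))"
    by (rule sum.UNION_disjoint)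
      (auto simp: finite_boxed_sets intro: finite_sorted_lists finite_boxed_set, auto simp: sorted_lists_def)
  also have "\<dots> = (\<Sum>S\<in>boxed_sets k l. cell_weight v q S * of_nat (card (sorted_lists S n)))"
    by (rule sum.cong) (auto simp: sorted_lists_def mult.commute)
  also have "\<dots> = (\<Sum>S\<in>boxed_sets k l. (fps_const (cell_weight v q S) * s_t ^ card S) $ n)"
    by (rule sum.cong) (simp_all add: fps_sorted_lists[symmetric] finite_boxed_set)
  finally show ?thesis by (simp add: fps_sum_nth)
qed

section \<open>Coefficients of the generating function\<close>

lemma fps_divide_eqI:
  fixes f g h :: "'a::field_char_0 fps3"
  assumes "g $ 0 $ 0 $ 0 \<noteq> 0" "h * g = f"
  shows "f / g = h"
proof -
  have "f / g * g = h * g" using fps3_divide_mult[OF assms(1)] assms(2) by simp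
  moreover have "g \<noteq> 0" using assms(1) by auto
  ultimately show ?thesis by simp
qed

lemma const_t_mult_nth:
  fixes f :: "'a::field_char_0 fps"
  shows "(const_t f * F) $ k $ l = f * (F $ k $ l)"
  by (simp add: const_t_def)

text \<open>The fraction \<open>u ^ des n \<pi> / (1 - u) ^ n\<close> is the series of word counts
  for \<open>\<pi>\<close>, and likewise in \<open>x\<close> for \<open>inv \<pi>\<close>; the
  coefficients multiply to the number of placements of \<open>\<pi>\<close>.\<close>

lemma gen_fun_term_nth:
  fixes v q :: "'a::field_char_0"
  assumes "n \<ge> 1"
  shows "gen_fun_term var_t var_x var_u (const_K v) (const_K q) 1 n $ k $ l =
    fps_X ^ n * fps_const ((\<Sum>S\<in>boxed_sets k l. fps_const (cell_weight v q S) * s_t ^ card S) $ n)"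
proof -
  define D :: "(nat \<Rightarrow> nat) \<Rightarrow> 'a fps3" where
    "D \<pi> = Abs_fps (\<lambda>k. of_nat (card (seqs n \<pi> k)))" for \<pi>
  define E :: "(nat \<Rightarrow> nat) \<Rightarrow> 'a fps3" where
    "E \<pi> = fps_const (Abs_fps (\<lambda>l. of_nat (card (seqs n (inv \<pi>) l))))" for \<pi>
  have quot: "(var_u ^ des n \<pi> * var_x ^ ides n \<pi> * const_K q ^ lmin n \<pi> * const_K v ^ rmax n \<pi> *
        1 ^ lmax n \<pi>) / ((1 - var_u) ^ n * (1 - var_x) ^ n) =
      const_K (q ^ lmin n \<pi> * v ^ rmax n \<pi>) * (D \<pi> * E \<pi>)" if "\<pi> \<in> perms n" for \<pi>
  proof (rule fps_divide_eqI[OF fps3_denominators_nonzero(4)])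
    have \<pi>: "\<pi> permutes {1..n}" using that by (simp add: perms_def)
    have D: "D \<pi> * (1 - var_u) ^ n = var_u ^ des n \<pi>"
      unfolding D_def var_u_def by (rule fps_seqs[OF assms permutes_inj[OF \<pi>]])
    have E: "E \<pi> * (1 - var_x) ^ n = var_x ^ ides n \<pi>"
    proof -
      have "1 - var_x = (fps_const (1 - fps_X) :: 'a fps3)"
        by (simp add: var_x_def fps_const_sub[symmetric] del: fps_const_sub)
      hence "E \<pi> * (1 - var_x) ^ n =
          fps_const (Abs_fps (\<lambda>l. of_nat (card (seqs n (inv \<pi>) l))) * (1 - fps_X) ^ n)"
        by (simp add: E_def)
      also have "\<dots> = fps_const (fps_X ^ ides n \<pi>)"
        unfolding ides_def by (simp only: fps_seqs[OF assms permutes_inj[OF permutes_inv[OF \<pi>]]])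
      finally show ?thesis by (simp add: var_x_def)
    qed
    have K: "const_K (q ^ lmin n \<pi> * v ^ rmax n \<pi>) = const_K q ^ lmin n \<pi> * const_K v ^ rmax n \<pi>"
      by (simp add: const_K_def const_t_def)
    have "const_K (q ^ lmin n \<pi> * v ^ rmax n \<pi>) * (D \<pi> * E \<pi>) *
        ((1 - var_u) ^ n * (1 - var_x) ^ n) =
      (D \<pi> * (1 - var_u) ^ n) * (E \<pi> * (1 - var_x) ^ n) *
        const_K (q ^ lmin n \<pi> * v ^ rmax n \<pi>)"
      by (simp only: ac_simps)
    thus "const_K (q ^ lmin n \<pi> * v ^ rmax n \<pi>) * (D \<pi> * E \<pi>) *
        ((1 - var_u) ^ n * (1 - var_x) ^ n) =
      var_u ^ des n \<pi> * var_x ^ ides n \<pi> * const_K q ^ lmin n \<pi> * const_K v ^ rmax n \<pi> *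
        1 ^ lmax n \<pi>"
      by (simp only: D E K power_one mult_1_right mult.assoc)
  qed
  have coeff: "(const_K c * (D \<pi> * E \<pi>)) $ k $ l =
      fps_const (c * (of_nat (card (seqs n \<pi> k)) * of_nat (card (seqs n (inv \<pi>) l))))" for c \<pi>
  proof -
    have "(D \<pi> * E \<pi>) $ k $ l =
        of_nat (card (seqs n \<pi> k)) * of_nat (card (seqs n (inv \<pi>) l))"
      by (simp add: D_def E_def fps_of_nat[symmetric] del: fps_of_nat)
    thus ?thesis
      unfolding const_K_def const_t_mult_nth
      by (simp add: fps_of_nat[symmetric] del: fps_of_nat)
  qed
  have "gen_fun_term var_t var_x var_u (const_K v) (const_K q) 1 n =
      var_t ^ n * (\<Sum>\<pi>\<in>perms n. const_K (q ^ lmin n \<pi> * v ^ rmax n \<pi>) * (D \<pi> * E \<pi>))"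
    unfolding gen_fun_term_def using quot by (simp cong: sum.cong)
  also have "var_t ^ n = (const_t (fps_X ^ n) :: 'a fps3)" by (simp add: var_t_def const_t_def)
  finally have "gen_fun_term var_t var_x var_u (const_K v) (const_K q) 1 n $ k $ l =
      fps_X ^ n * (\<Sum>\<pi>\<in>perms n. fps_const (q ^ lmin n \<pi> * v ^ rmax n \<pi> *
        (of_nat (card (seqs n \<pi> k)) * of_nat (card (seqs n (inv \<pi>) l)))))"
    by (simp only: const_t_mult_nth fps_sum_nth coeff)
  also have "(\<Sum>\<pi>\<in>perms n. fps_const (q ^ lmin n \<pi> * v ^ rmax n \<pi> *
        (of_nat (card (seqs n \<pi> k)) * of_nat (card (seqs n (inv \<pi>) l))))) =
      fps_const (\<Sum>\<pi>\<in>perms n. q ^ lmin n \<pi> * v ^ rmax n \<pi> *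
        (of_nat (card (seqs n \<pi> k)) * of_nat (card (seqs n (inv \<pi>) l))))"
    by (rule fps_ext) (simp add: fps_sum_nth)
  finally show ?thesis unfolding sum_perms_boxed[OF assms] .
qed

text \<open>The coefficient of the summand with index \<open>n\<close> is a multiple of
  \<open>t ^ n\<close> by a constant, so summing over \<open>n\<close> merely assembles a series
  from its coefficients.\<close>

lemma gen_fun_nth:
  fixes v q :: "'a::field_char_0"
  shows "gen_fun var_t var_x var_u (const_K v) (const_K q) 1 $ k $ l =
    (\<Sum>S\<in>boxed_sets k l. fps_const (cell_weight v q S) * s_t ^ card S)" (is "_ = ?W")
proof (rule fps_ext)
  fix m
  let ?T = "\<lambda>n. gen_fun_term var_t var_x var_u (const_K v) (const_K q) 1 n $ k $ l $ m"
  have T: "?T n = (if n = m then ?W $ m else 0)" if "n \<ge> 1" for n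
    unfolding gen_fun_term_nth[OF that] by (auto simp: fps_X_power_mult_nth)
  have "gen_fun var_t var_x var_u (const_K v) (const_K q) 1 $ k $ l $ m =
      (\<Sum>n\<in>{n \<in> {1..}. ?T n \<noteq> 0}. ?T n)"
    by (simp add: gen_fun_def fps3_infsum_def)
  also have "\<dots> = (\<Sum>n\<in>{n \<in> {1..}. ?T n \<noteq> 0}. if n = m then ?W $ m else 0)"
    by (rule sum.cong) (use T in auto)
  also have "\<dots> = ?W $ m"
  \<comment> \<open>The sum starts at \<open>n = 1\<close>, so the constant term on the right has to
    vanish. It does, because boxed sets are nonempty and \<open>s_t\<close> has no constant
    term.\<close>
  proof (cases "m = 0")
    case True
    have "(s_t ^ card S :: 'a fps) $ 0 = 0" if "S \<in> boxed_sets k l" for S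
    proof -
      have "S \<noteq> {}" using that by (auto simp: boxed_sets_def)
      thus ?thesis using finite_boxed_set[OF that]
        by (simp add: fps_power_zeroth s_t_def card_gt_0_iff)
    qed
    hence "?W $ 0 = 0"
      unfolding fps_sum_nth by (intro sum.neutral ballI) (simp only: fps_mult_left_const_nth mult_zero_right)
    thus ?thesis using True by (auto intro: sum.neutral)
  next
    case False
    have "{n \<in> {1..}. ?T n \<noteq> 0} \<subseteq> {m}" using T by (auto split: if_splits)
    moreover have "?T m = ?W $ m" using T[of m] False by simp
    ultimately have "{n \<in> {1..}. ?T n \<noteq> 0} = (if ?W $ m = 0 then {} else {m})"
      using False by auto
    thus ?thesis by auto
  qed
  finally show "gen_fun var_t var_x var_u (const_K v) (const_K q) 1 $ k $ l $ m = ?W $ m" .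
qed

subsection \<open>Removing the first column of a grid\<close>

text \<open>The top row must be occupied but the last column need not be; differences in
  \<open>K\<close> restore that condition at the end. A set of cells has exactly one height
  \<open>h\<close>, which is \<open>0\<close> only for the empty set.\<close>

definition grid_sets :: "nat \<Rightarrow> nat \<Rightarrow> (nat \<times> nat) set set" where
  "grid_sets K h = {S. S \<subseteq> {..<K} \<times> {..<h} \<and> (h > 0 \<longrightarrow> h - 1 \<in> snd ` S)}"

text \<open>\<open>Q\<close> is the set of rows occupied by the columns in front of the grid.\<close>

definition below :: "nat set \<Rightarrow> (nat \<times> nat) set \<Rightarrow> (nat \<times> nat) set" where
  "below Q S = {p \<in> sw_min S. \<forall>b\<in>Q. snd p < b}"

text \<open>The condition for the lowest cell of a first column \<open>c\<close> to be a counted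
  minimum.\<close>

definition opens :: "nat set \<Rightarrow> nat set \<Rightarrow> bool" where
  "opens Q c \<longleftrightarrow> c \<noteq> {} \<and> (\<forall>b\<in>Q. Min c < b)"

definition shift :: "nat \<times> nat \<Rightarrow> nat \<times> nat" where "shift p = (Suc (fst p), snd p)"

definition add_column :: "nat set \<Rightarrow> (nat \<times> nat) set \<Rightarrow> (nat \<times> nat) set" where
  "add_column c S = Pair 0 ` c \<union> shift ` S"

lemma inj_shift: "inj shift" by (auto simp: inj_def shift_def prod_eq_iff)

lemma mem_add_column:
  "p \<in> add_column c S \<longleftrightarrow> (case fst p of 0 \<Rightarrow> snd p \<in> c | Suc a \<Rightarrow> (a, snd p) \<in> S)"
  by (cases p) (force simp: add_column_def shift_def image_iff split: nat.split)

lemma ball_add_column: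
  "(\<forall>p\<in>add_column c S. P p) \<longleftrightarrow> (\<forall>b\<in>c. P (0, b)) \<and> (\<forall>p\<in>S. P (shift p))"
  by (auto simp: add_column_def)

lemma finite_grid_sets: "finite (grid_sets K h)"
  by (rule finite_subset[of _ "Pow ({..<K} \<times> {..<h})"]) (auto simp: grid_sets_def)

lemma finite_grid_set: "S \<in> grid_sets K h \<Longrightarrow> finite S"
  by (rule finite_subset[of _ "{..<K} \<times> {..<h}"]) (auto simp: grid_sets_def)

lemma card_add_column:
  assumes "finite c" "finite S"
  shows "card (add_column c S) = card c + card S"
proof -
  have "card (add_column c S) = card (Pair (0::nat) ` c) + card (shift ` S)"
    unfolding add_column_def
    by (rule card_Un_disjoint) (use assms in \<open>auto simp: shift_def\<close>)
  also have "\<dots> = card c + card S"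
    by (simp add: card_image inj_on_def[of "Pair (0::nat)"] inj_on_subset[OF inj_shift])
  finally show ?thesis .
qed

text \<open>The new cells lie west of all others and so leave their maximality unchanged. If the
  column rises above \<open>S\<close>, its top cell is a new maximum that dominates the column; if
  the heights agree, a cell of \<open>S\<close> in the top row does so.\<close>

lemma ne_max_add_column:
  assumes S: "S \<in> grid_sets K h0" and h0: "h0 \<le> h" and c: "c \<subseteq> {..<h}"
    and top: "h0 < h \<Longrightarrow> h - 1 \<in> c"
  shows "card (ne_max (add_column c S)) = card (ne_max S) + (if h0 < h then 1 else 0)"
proof -
  have shift: "shift p \<in> ne_max (add_column c S) \<longleftrightarrow> p \<in> ne_max S" for p
    unfolding ne_max_def mem_Collect_eq ball_add_column
    by (auto simp: mem_add_column shift_def prod_eq_iff)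
  have rows: "snd p < h0" if "p \<in> S" for p using S that by (auto simp: grid_sets_def)
  have col0: "(0, b) \<in> ne_max (add_column c S) \<longleftrightarrow> h0 < h \<and> b = h - 1" for b
  proof
    assume L: "(0, b) \<in> ne_max (add_column c S)"
    hence b: "b \<in> c" "b < h" and max: "\<And>p. p \<in> add_column c S \<Longrightarrow> b \<le> snd p \<Longrightarrow> p = (0, b)"
      using c by (auto simp: ne_max_def mem_add_column)
    have "h0 < h"
    proof (rule ccontr)
      assume "\<not> h0 < h"
      hence "h0 = h" "h > 0" using h0 b by auto
      then obtain a where "(a, h - 1) \<in> S" using S by (auto simp: grid_sets_def)
      hence "(Suc a, h - 1) \<in> add_column c S" by (simp add: mem_add_column)
      moreover have "b \<le> h - 1" using b(2) by simp
      ultimately show False using max[of "(Suc a, h - 1)"] by simp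
    qed
    moreover have "b \<le> h - 1" using b(2) by simp
    hence "b = h - 1"
      using max[of "(0, h - 1)"] top[OF calculation] by (simp add: mem_add_column)
    ultimately show "h0 < h \<and> b = h - 1" by blast
  next
    assume R: "h0 < h \<and> b = h - 1"
    have "p = (0, b)" if "p \<in> add_column c S" "b \<le> snd p" for p
    proof (cases "fst p")
      case 0
      hence "snd p < h" using that(1) c by (auto simp: mem_add_column)
      thus ?thesis using 0 R that(2) by (auto simp: prod_eq_iff)
    next
      case (Suc a)
      hence "(a, snd p) \<in> S" using that(1) by (simp add: mem_add_column)
      hence "snd p < h0" using rows by fastforce
      hence False using R that(2) by linarith
      thus ?thesis ..
    qed
    thus "(0, b) \<in> ne_max (add_column c S)" using top R by (auto simp: ne_max_def mem_add_column)
  qed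
  have fin: "finite (shift ` ne_max S)"
    using finite_grid_set[OF S] by (simp add: ne_max_def)
  have "ne_max (add_column c S) = shift ` ne_max S \<union> (if h0 < h then {(0, h - 1)} else {})"
  proof (intro set_eqI)
    fix p
    show "p \<in> ne_max (add_column c S) \<longleftrightarrow>
        p \<in> shift ` ne_max S \<union> (if h0 < h then {(0, h - 1)} else {})"
    proof (cases p)
      case (Pair a b)
      show ?thesis
      proof (cases a)
        case 0
        thus ?thesis using col0[of b] Pair by (auto simp: shift_def)
      next
        case (Suc a')
        hence p: "p = shift (a', b)" using Pair by (simp add: shift_def)
        have "p \<in> shift ` ne_max S \<longleftrightarrow> (a', b) \<in> ne_max S"
          unfolding p by (rule inj_image_mem_iff[OF inj_shift])
        thus ?thesis using shift[of "(a', b)"] p Suc Pair by auto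
      qed
    qed
  qed
  moreover have "card (shift ` ne_max S) = card (ne_max S)"
    by (rule card_image) (rule inj_on_subset[OF inj_shift], simp)
  moreover have "(0, h - 1) \<notin> shift ` ne_max S" by (auto simp: shift_def)
  ultimately show ?thesis using fin by simp
qed

text \<open>A cell of \<open>S\<close> has no cell of the new column weakly south-west of it exactly
  if its row is below all of \<open>c\<close>, so \<open>c\<close> joins the front rows. In the
  column itself only the lowest cell can be minimal.\<close>

lemma below_add_column:
  assumes "finite S" "finite c"
  shows "card (below Q (add_column c S)) = card (below (Q \<union> c) S) + (if opens Q c then 1 else 0)"
proof -
  have shift: "shift p \<in> below Q (add_column c S) \<longleftrightarrow> p \<in> below (Q \<union> c) S" for p
    unfolding below_def sw_min_def mem_Collect_eq ball_add_column
    by (auto simp: mem_add_column shift_def prod_eq_iff not_le[symmetric])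
  have col0: "(0, b) \<in> below Q (add_column c S) \<longleftrightarrow> opens Q c \<and> b = Min c" for b
  proof -
    have "(0, b) \<in> sw_min (add_column c S) \<longleftrightarrow> b \<in> c \<and> (\<forall>b'\<in>c. b \<le> b')"
      unfolding sw_min_def mem_Collect_eq ball_add_column
      by (auto simp: mem_add_column shift_def)
    also have "\<dots> \<longleftrightarrow> c \<noteq> {} \<and> b = Min c"
      by (metis Min_eqI Min_in Min_le assms(2) empty_iff)
    finally show ?thesis by (auto simp: below_def opens_def)
  qed
  have fin: "finite (shift ` below (Q \<union> c) S)"
    using assms(1) by (simp add: below_def sw_min_def)
  have "below Q (add_column c S) =
      shift ` below (Q \<union> c) S \<union> (if opens Q c then {(0, Min c)} else {})"
  proof (intro set_eqI)
    fix p
    show "p \<in> below Q (add_column c S) \<longleftrightarrow>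
        p \<in> shift ` below (Q \<union> c) S \<union> (if opens Q c then {(0, Min c)} else {})"
    proof (cases p)
      case (Pair a b)
      show ?thesis
      proof (cases a)
        case 0
        thus ?thesis using col0[of b] Pair by (auto simp: shift_def)
      next
        case (Suc a')
        hence p: "p = shift (a', b)" using Pair by (simp add: shift_def)
        have "p \<in> shift ` below (Q \<union> c) S \<longleftrightarrow> (a', b) \<in> below (Q \<union> c) S"
          unfolding p by (rule inj_image_mem_iff[OF inj_shift])
        thus ?thesis using shift[of "(a', b)"] p Suc Pair by auto
      qed
    qed
  qed
  moreover have "card (shift ` below (Q \<union> c) S) = card (below (Q \<union> c) S)"
    by (rule card_image) (rule inj_on_subset[OF inj_shift], simp)
  moreover have "(0, Min c) \<notin> shift ` below (Q \<union> c) S" by (auto simp: shift_def)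
  ultimately show ?thesis using fin by simp
qed

text \<open>The columns that turn a grid set of height \<open>h0\<close> into one of height
  \<open>h\<close>: an increase in height must come from the column.\<close>

definition columns :: "nat \<Rightarrow> nat \<Rightarrow> nat set set" where
  "columns h0 h = {c. c \<subseteq> {..<h} \<and> (h0 < h \<longrightarrow> h - 1 \<in> c)}"

lemma finite_columns: "finite (columns h0 h)"
  by (rule finite_subset[of _ "Pow {..<h}"]) (auto simp: columns_def)

lemma finite_column: "c \<in> columns h0 h \<Longrightarrow> finite c"
  by (auto simp: columns_def intro: finite_subset)

text \<open>Splitting off the first column is unambiguous because the remaining cells determine
  their height, which is the parameter \<open>h0\<close>.\<close>

lemma bij_betw_add_column:
  "bij_betw (\<lambda>(h0, c, S). add_column c S)
     (SIGMA h0:{..h}. columns h0 h \<times> grid_sets K h0) (grid_sets (Suc K) h)"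
  (is "bij_betw ?f ?A ?B")
  unfolding bij_betw_def
proof (intro conjI subset_antisym)
  have height: "h0 = h1" if "S \<in> grid_sets K h0" "S \<in> grid_sets K h1" for S h0 h1
  proof -
    have "\<not> h0 < h1" if "S \<in> grid_sets K h0" "S \<in> grid_sets K h1" for h0 h1
    proof
      assume "h0 < h1"
      hence "h1 - 1 \<in> snd ` S" "snd ` S \<subseteq> {..<h0}" using that by (auto simp: grid_sets_def)
      hence "h1 - 1 < h0" by blast
      thus False using \<open>h0 < h1\<close> by simp
    qed
    thus ?thesis using that by (meson linorder_neqE_nat)
  qed
  show "inj_on ?f ?A"
  proof (rule inj_onI)
    fix x y assume x: "x \<in> ?A" and y: "y \<in> ?A" and eq: "?f x = ?f y"
    obtain h0 c S h1 c' S' where xy: "x = (h0, c, S)" "y = (h1, c', S')" by (metis prod_cases3)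
    have eq: "add_column c S = add_column c' S'" using eq by (simp add: xy)
    have "b \<in> c \<longleftrightarrow> b \<in> c'" for b
      using mem_add_column[of "(0, b)" c S] mem_add_column[of "(0, b)" c' S'] eq by simp
    hence "c = c'" by blast
    have "(a, b) \<in> S \<longleftrightarrow> (a, b) \<in> S'" for a b
      using mem_add_column[of "(Suc a, b)" c S] mem_add_column[of "(Suc a, b)" c' S'] eq by simp
    hence "S = S'" by auto
    thus "x = y" using \<open>c = c'\<close> x y height unfolding xy by auto
  qed
  show "?f ` ?A \<subseteq> ?B"
  proof (rule image_subsetI)
    fix x assume x: "x \<in> ?A"
    obtain h0 c S where [simp]: "x = (h0, c, S)" by (metis prod_cases3)
    have A: "h0 \<le> h" "c \<in> columns h0 h" "S \<in> grid_sets K h0" using x by auto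
    have "add_column c S \<subseteq> {..<Suc K} \<times> {..<h}"
    proof -
      have "c \<subseteq> {..<h}" "S \<subseteq> {..<K} \<times> {..<h}" using A by (auto simp: columns_def grid_sets_def)
      thus ?thesis by (auto simp: add_column_def shift_def)
    qed
    moreover have "h - 1 \<in> snd ` add_column c S" if "h > 0"
    proof (cases "h0 < h")
      case True
      hence "h - 1 \<in> c" using A by (simp add: columns_def)
      thus ?thesis by (force simp: add_column_def)
    next
      case False
      hence "h0 = h" using A by simp
      hence "h - 1 \<in> snd ` S" using that A by (simp add: grid_sets_def)
      thus ?thesis by (force simp: add_column_def shift_def)
    qed
    ultimately show "?f x \<in> ?B" by (simp add: grid_sets_def)
  qed
  show "?B \<subseteq> ?f ` ?A"
  proof
    fix T assume T: "T \<in> ?B"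
    define c where "c = {b. (0, b) \<in> T}"
    define S where "S = {(a, b). (Suc a, b) \<in> T}"
    \<comment> \<open>One more than the highest occupied row, and \<open>0\<close> if the remaining
      columns are empty.\<close>
    define h0 where "h0 = (if S = {} then 0 else Suc (Max (snd ` S)))"
    have Teq: "T = add_column c S"
      by (rule set_eqI) (auto simp: mem_add_column c_def S_def split: nat.splits)
    have sub: "T \<subseteq> {..<Suc K} \<times> {..<h}" using T by (simp add: grid_sets_def)
    have S_sub: "S \<subseteq> {..<K} \<times> {..<h}" using sub by (auto simp: S_def)
    hence fin: "finite (snd ` S)" by (meson finite_SigmaI finite_imageI finite_lessThan finite_subset)
    have "h0 \<le> h"
    proof (cases "S = {}")
      case False
      have "Max (snd ` S) \<in> snd ` S" using fin False by simp
      thus ?thesis using False S_sub by (auto simp: h0_def)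
    qed (simp add: h0_def)
    moreover have "S \<in> grid_sets K h0"
    proof (cases "S = {}")
      case False
      have "snd p < h0" if "p \<in> S" for p using fin that False by (auto simp: h0_def less_Suc_eq_le)
      moreover have "Max (snd ` S) \<in> snd ` S" using fin False by simp
      moreover have "S \<subseteq> {..<K} \<times> {..<h0}" using calculation(1) S_sub by fastforce
      ultimately show ?thesis using False by (simp add: grid_sets_def h0_def)
    qed (simp add: grid_sets_def h0_def)
    moreover have "c \<in> columns h0 h"
    proof -
      have "h - 1 \<in> c" if "h0 < h"
      proof -
        have "h - 1 \<in> snd ` T" using T that by (simp add: grid_sets_def)
        then obtain a where a: "(a, h - 1) \<in> T" by force
        show ?thesis
        proof (cases a)
          case 0 thus ?thesis using a by (simp add: c_def)
        next
          case (Suc a')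
          hence "(a', h - 1) \<in> S" using a by (simp add: S_def)
          hence "h - 1 < h0" using \<open>S \<in> grid_sets K h0\<close> by (auto simp: grid_sets_def)
          thus ?thesis using that by simp
        qed
      qed
      thus ?thesis using sub by (auto simp: columns_def c_def)
    qed
    ultimately have "(h0, c, S) \<in> ?A" by simp
    thus "T \<in> ?f ` ?A" using Teq by force
  qed
qed

subsection \<open>Merging a column into the front columns\<close>

lemma sum_Pow_lessThan_Suc:
  "(\<Sum>Q\<in>Pow {..<Suc h}. G Q) = (\<Sum>Q\<in>Pow {..<h}. G Q + G (insert h Q) :: 'b::comm_monoid_add)"
proof -
  have "Pow {..<Suc h} = Pow {..<h} \<union> insert h ` Pow {..<h}"
    by (simp only: lessThan_Suc Pow_insert)
  moreover have "Pow {..<h} \<inter> insert h ` Pow {..<h} = {}" by auto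
  moreover have "inj_on (insert h) (Pow {..<h})"
    by (rule inj_onI) (metis Diff_insert_absorb PowD lessThan_iff order.irrefl subsetD)
  ultimately show ?thesis by (simp add: sum.union_disjoint sum.reindex sum.distrib)
qed

text \<open>A row \<open>h\<close> above all others matters only if the column occupies it and no
  other row is occupied, in the column or in front.\<close>

lemma opens_insert:
  assumes "Q \<subseteq> {..<h}" "c \<subseteq> {..<h}"
  shows "opens (insert h Q) c \<longleftrightarrow> opens Q c"
    and "opens Q (insert h c) \<longleftrightarrow> opens Q c \<or> (Q = {} \<and> c = {})"
    and "opens (insert h Q) (insert h c) \<longleftrightarrow> opens Q c"
proof -
  have fin: "finite c" using assms(2) finite_subset by blast
  have Min: "Min c < h" "Min (insert h c) = Min c" if "c \<noteq> {}"
  proof -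
    show "Min c < h" using Min_in[OF fin that] assms(2) by auto
    thus "Min (insert h c) = Min c" using fin that by simp
  qed
  have Q: "b < h" if "b \<in> Q" for b using that assms(1) by auto
  show "opens (insert h Q) c \<longleftrightarrow> opens Q c" using Min by (auto simp: opens_def)
  show "opens Q (insert h c) \<longleftrightarrow> opens Q c \<or> (Q = {} \<and> c = {})"
    using Min Q by (cases "c = {}") (auto simp: opens_def dest: order.asym)
  show "opens (insert h Q) (insert h c) \<longleftrightarrow> opens Q c"
    using Min Q by (cases "c = {}") (auto simp: opens_def)
qed

definition pair_weight :: "'b \<Rightarrow> 'b \<Rightarrow> 'b \<Rightarrow> nat set \<Rightarrow> nat set \<Rightarrow> 'b::comm_ring_1" where
  "pair_weight y s q Q c = y ^ card Q * s ^ card c * (if opens Q c then q else 1)"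

lemma pair_weight_insert:
  assumes "Q \<subseteq> {..<h}" "c \<subseteq> {..<h}"
  shows "pair_weight y s q (insert h Q) c = y * pair_weight y s q Q c"
    and "pair_weight y s q Q (insert h c) = s * pair_weight y s q Q c +
      (if Q = {} \<and> c = {} then (q - 1) * s else 0)"
    and "pair_weight y s q (insert h Q) (insert h c) = y * s * pair_weight y s q Q c"
proof -
  have fin: "finite Q" "finite c" using assms finite_subset by blast+
  have h: "h \<notin> Q" "h \<notin> c" using assms by auto
  show "pair_weight y s q (insert h Q) c = y * pair_weight y s q Q c"
    and "pair_weight y s q (insert h Q) (insert h c) = y * s * pair_weight y s q Q c"
    using fin h by (simp_all add: pair_weight_def opens_insert[OF assms] ac_simps)
  have "\<not> opens {} {}" by (simp add: opens_def)
  thus "pair_weight y s q Q (insert h c) = s * pair_weight y s q Q c +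
      (if Q = {} \<and> c = {} then (q - 1) * s else 0)"
    using fin h by (auto simp: pair_weight_def opens_insert[OF assms] algebra_simps)
qed

definition merge_sum ::
  "'b \<Rightarrow> 'b \<Rightarrow> 'b \<Rightarrow> nat \<Rightarrow> (nat set \<Rightarrow> 'b) \<Rightarrow> 'b::comm_ring_1" where
  "merge_sum y s q h g =
     (\<Sum>Q\<in>Pow {..<h}. \<Sum>c\<in>Pow {..<h}. pair_weight y s q Q c * g (Q \<union> c))"

definition subset_sum :: "'b \<Rightarrow> nat \<Rightarrow> (nat set \<Rightarrow> 'b) \<Rightarrow> 'b::comm_ring_1" where
  "subset_sum p h g = (\<Sum>R\<in>Pow {..<h}. p ^ card R * g R)"

lemma subset_sum_Suc:
  "subset_sum p (Suc h) g = subset_sum p h (\<lambda>R. g R + p * g (insert h R))"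
  unfolding subset_sum_def sum_Pow_lessThan_Suc
proof (rule sum.cong)
  fix R assume "R \<in> Pow {..<h}"
  hence "finite R" "h \<notin> R" using finite_subset by auto
  thus "p ^ card R * g R + p ^ card (insert h R) * g (insert h R) =
      p ^ card R * (g R + p * g (insert h R))"
    by (simp add: algebra_simps)
qed simp

text \<open>Each of the \<open>d\<close> rows ignored by \<open>g\<close> may be absent or present,
  which gives a factor \<open>1 + p\<close>.\<close>

lemma subset_sum_above:
  assumes "\<And>h R. h \<ge> h0 \<Longrightarrow> g (insert h R) = g R"
  shows "subset_sum p (h0 + d) g = (1 + p) ^ d * subset_sum p h0 g"
proof (induction d)
  case (Suc d)
  have "subset_sum p (h0 + Suc d) g = subset_sum p (h0 + d) (\<lambda>R. (1 + p) * g R)"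
    by (simp add: subset_sum_Suc assms algebra_simps)
  also have "\<dots> = (1 + p) * subset_sum p (h0 + d) g"
    by (simp add: subset_sum_def sum_distrib_left ac_simps)
  finally show ?case using Suc by (simp add: ac_simps)
qed simp

lemma sum_Pow_Pow_empty:
  "(\<Sum>Q\<in>Pow {..<h::nat}. \<Sum>c\<in>Pow {..<h}. if Q = {} \<and> c = {} then z else (0 :: 'b::comm_monoid_add)) = z"
proof -
  have "(\<Sum>c\<in>Pow {..<h}. if Q = {} \<and> c = {} then z else 0) = (if Q = {} then z else 0)" for Q :: "nat set"
    by (cases "Q = {}") (simp_all add: sum.delta)
  thus ?thesis by (simp add: sum.delta)
qed

text \<open>The set \<open>R\<close> is the union \<open>Q \<union> c\<close>; a row of \<open>R\<close> has weight \<open>y + s + y s\<close>, except that the lowest one has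
  weight \<open>y + y s + q s\<close>. The empty set has no lowest row, whence the correction term.\<close>

lemma merge_sum_eq:
  assumes "\<phi> * (y + s + y * s) = y + y * s + q * s"
  shows "merge_sum y s q h g = \<phi> * subset_sum (y + s + y * s) h g + (1 - \<phi>) * g {}"
proof (induction h arbitrary: g)
  case 0
  show ?case by (simp add: merge_sum_def subset_sum_def pair_weight_def opens_def algebra_simps)
next
  case (Suc h)
  let ?p = "y + s + y * s"
  let ?w = "pair_weight y s q"
  \<comment> \<open>The states of the top row \<open>h\<close> (unoccupied, in \<open>Q\<close>, in
    \<open>c\<close>, in both) have weights \<open>1\<close>, \<open>y\<close>, \<open>s\<close> and
    \<open>y * s\<close>; the extra term arises when \<open>h\<close> is the only occupied row and
    lies in \<open>c\<close> alone.\<close>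
  have "merge_sum y s q (Suc h) g =
      (\<Sum>Q\<in>Pow {..<h}. \<Sum>c\<in>Pow {..<h}. ?w Q c * (g (Q \<union> c) + ?p * g (insert h (Q \<union> c))) +
        (if Q = {} \<and> c = {} then (q - 1) * s * g {h} else 0))"
    unfolding merge_sum_def sum_Pow_lessThan_Suc sum.distrib[symmetric]
  proof (intro sum.cong refl)
    fix Q c :: "nat set" assume "Q \<in> Pow {..<h}" "c \<in> Pow {..<h}"
    hence "Q \<subseteq> {..<h}" "c \<subseteq> {..<h}" by auto
    note ins = pair_weight_insert[OF this]
    show "?w Q c * g (Q \<union> c) + ?w Q (insert h c) * g (Q \<union> insert h c) +
        (?w (insert h Q) c * g (insert h Q \<union> c) +
         ?w (insert h Q) (insert h c) * g (insert h Q \<union> insert h c)) =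
      ?w Q c * (g (Q \<union> c) + ?p * g (insert h (Q \<union> c))) +
        (if Q = {} \<and> c = {} then (q - 1) * s * g {h} else 0)"
      unfolding ins by (auto simp: algebra_simps)
  qed
  also have "\<dots> = merge_sum y s q h (\<lambda>R. g R + ?p * g (insert h R)) + (q - 1) * s * g {h}"
    unfolding sum.distrib sum_Pow_Pow_empty by (simp add: merge_sum_def)
  also have "\<dots> = \<phi> * subset_sum ?p (Suc h) g +
      ((1 - \<phi>) * (g {} + ?p * g {h}) + (q - 1) * s * g {h})"
    unfolding Suc subset_sum_Suc by (simp add: add.assoc)
  also have "(1 - \<phi>) * (g {} + ?p * g {h}) + (q - 1) * s * g {h} =
      (1 - \<phi>) * g {} + (?p - \<phi> * ?p + (q - 1) * s) * g {h}" by (simp add: algebra_simps)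
  \<comment> \<open>The assumption on \<open>\<phi>\<close> is what makes the coefficient of
    \<open>g {h}\<close> vanish, so that the correction involves the empty set only, for every
    height.\<close>
  also have "?p - \<phi> * ?p + (q - 1) * s = 0" unfolding assms by (simp add: algebra_simps)
  finally show ?case by simp
qed

text \<open>The column contains the top row \<open>h\<close>, which \<open>g\<close> ignores and
  which contributes \<open>(1 + y) * s\<close>; the ignored rows from \<open>h0\<close> to
  \<open>h - 1\<close> are summed freely. If no row below \<open>h\<close> is occupied, the true
  weight of row \<open>h\<close> is \<open>s * (q + y)\<close>, whence the correction at the empty
  set.\<close>

lemma merge_sum_top:
  assumes \<phi>: "\<phi> * (y + s + y * s) = y + y * s + q * s"
    and g: "\<And>h R. h \<ge> h0 \<Longrightarrow> g (insert h R) = g R" and "h0 \<le> h"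
  shows "(\<Sum>Q\<in>Pow {..<Suc h}. \<Sum>c\<in>Pow {..<h}. pair_weight y s q Q (insert h c) * g (Q \<union> insert h c)) =
    (1 + y) * s * \<phi> * (1 + (y + s + y * s)) ^ (h - h0) * subset_sum (y + s + y * s) h0 g +
    (s * (q + y) - (1 + y) * s * \<phi>) * g {}"
proof -
  let ?w = "pair_weight y s q"
  have "(\<Sum>Q\<in>Pow {..<Suc h}. \<Sum>c\<in>Pow {..<h}. ?w Q (insert h c) * g (Q \<union> insert h c)) =
      (\<Sum>Q\<in>Pow {..<h}. \<Sum>c\<in>Pow {..<h}. (1 + y) * s * (?w Q c * g (Q \<union> c)) +
        (if Q = {} \<and> c = {} then (q - 1) * s * g {} else 0))"
    unfolding sum_Pow_lessThan_Suc sum.distrib[symmetric]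
  proof (intro sum.cong refl)
    fix Q c :: "nat set" assume "Q \<in> Pow {..<h}" "c \<in> Pow {..<h}"
    hence "Q \<subseteq> {..<h}" "c \<subseteq> {..<h}" by auto
    note ins = pair_weight_insert[OF this]
    have "g (insert h R) = g R" for R using g assms(3) by simp
    thus "?w Q (insert h c) * g (Q \<union> insert h c) +
        ?w (insert h Q) (insert h c) * g (insert h Q \<union> insert h c) =
      (1 + y) * s * (?w Q c * g (Q \<union> c)) +
        (if Q = {} \<and> c = {} then (q - 1) * s * g {} else 0)"
      unfolding ins by (auto simp: algebra_simps)
  qed
  also have "\<dots> = (1 + y) * s * merge_sum y s q h g + (q - 1) * s * g {}"
    unfolding sum.distrib sum_Pow_Pow_empty by (simp add: merge_sum_def sum_distrib_left)
  also have "\<dots> = (1 + y) * s * \<phi> * subset_sum (y + s + y * s) h g +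
      (s * (q + y) - (1 + y) * s * \<phi>) * g {}"
    unfolding merge_sum_eq[OF \<phi>] by (simp add: algebra_simps)
  also have "subset_sum (y + s + y * s) h g =
      (1 + (y + s + y * s)) ^ (h - h0) * subset_sum (y + s + y * s) h0 g"
    using subset_sum_above[of h0 g _ "h - h0"] g assms(3) by simp
  finally show ?thesis by (simp only: mult.assoc)
qed

section \<open>The recursion in the number of columns\<close>

definition grid_sum :: "'b \<Rightarrow> 'b \<Rightarrow> 'b \<Rightarrow> nat \<Rightarrow> nat \<Rightarrow> nat set \<Rightarrow> 'b::comm_ring_1" where
  "grid_sum s v q K h Q =
     (\<Sum>S\<in>grid_sets K h. s ^ card S * v ^ card (ne_max S) * q ^ card (below Q S))"

text \<open>All cells of the grid lie below row \<open>r\<close>, so a front row \<open>r\<close>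
  excludes no minimum.\<close>

lemma grid_sum_above:
  assumes "r \<ge> h"
  shows "grid_sum s v q K h (insert r Q) = grid_sum s v q K h Q"
proof -
  have "below (insert r Q) S = below Q S" if "S \<in> grid_sets K h" for S
    using that assms by (fastforce simp: below_def sw_min_def grid_sets_def)
  thus ?thesis unfolding grid_sum_def by (intro sum.cong) auto
qed

text \<open>The first column contributes a maximum when it rises above the remainder and a minimum
  when it opens below \<open>Q\<close>; its rows then act as further front rows for the
  remainder.\<close>

lemma grid_sum_Suc:
  "grid_sum s v q (Suc K) h Q = (\<Sum>h0\<le>h. \<Sum>c\<in>columns h0 h.
     (if h0 < h then v else 1) * (s ^ card c * (if opens Q c then q else 1)) *
     grid_sum s v q K h0 (Q \<union> c))"
proof -
  let ?W = "\<lambda>K Q S. s ^ card S * v ^ card (ne_max S) * q ^ card (below Q S)"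
  have "grid_sum s v q (Suc K) h Q = (\<Sum>x\<in>(SIGMA h0:{..h}. columns h0 h \<times> grid_sets K h0).
      ?W K Q (case x of (h0, c, S) \<Rightarrow> add_column c S))"
    unfolding grid_sum_def by (rule sum.reindex_bij_betw[OF bij_betw_add_column, symmetric])
  also have "\<dots> = (\<Sum>h0\<le>h. \<Sum>x\<in>columns h0 h \<times> grid_sets K h0.
      ?W K Q (add_column (fst x) (snd x)))"
    by (subst sum.Sigma) (auto simp: finite_columns finite_grid_sets intro!: sum.cong)
  also have "\<dots> = (\<Sum>h0\<le>h. \<Sum>c\<in>columns h0 h. \<Sum>S\<in>grid_sets K h0. ?W K Q (add_column c S))"
    by (simp add: sum.cartesian_product case_prod_unfold)
  also have "\<dots> = (\<Sum>h0\<le>h. \<Sum>c\<in>columns h0 h. \<Sum>S\<in>grid_sets K h0.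
      (if h0 < h then v else 1) * (s ^ card c * (if opens Q c then q else 1)) * ?W K (Q \<union> c) S)"
  proof (intro sum.cong refl)
    fix h0 c S assume A: "h0 \<in> {..h}" "c \<in> columns h0 h" "S \<in> grid_sets K h0"
    have fin: "finite c" "finite S" using A finite_column finite_grid_set by auto
    have "card (ne_max (add_column c S)) = card (ne_max S) + (if h0 < h then 1 else 0)"
      by (rule ne_max_add_column[OF A(3)]) (use A in \<open>auto simp: columns_def\<close>)
    thus "?W K Q (add_column c S) =
        (if h0 < h then v else 1) * (s ^ card c * (if opens Q c then q else 1)) * ?W K (Q \<union> c) S"
      by (simp add: card_add_column[OF fin] below_add_column[OF fin(2,1)] power_add ac_simps)
  qed
  also have "\<dots> = (\<Sum>h0\<le>h. \<Sum>c\<in>columns h0 h.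
      (if h0 < h then v else 1) * (s ^ card c * (if opens Q c then q else 1)) *
      grid_sum s v q K h0 (Q \<union> c))"
    by (simp only: grid_sum_def sum_distrib_left)
  finally show ?thesis .
qed

lemma columns_Suc: "h0 \<le> h \<Longrightarrow> columns h0 (Suc h) = insert h ` Pow {..<h}"
proof (intro subset_antisym subsetI)
  fix c assume "h0 \<le> h" "c \<in> columns h0 (Suc h)"
  hence "c = insert h (c - {h})" "c - {h} \<in> Pow {..<h}" by (auto simp: columns_def less_Suc_eq)
  thus "c \<in> insert h ` Pow {..<h}" by blast
qed (auto simp: columns_def)

definition prefix_sum :: "'b \<Rightarrow> 'b \<Rightarrow> 'b \<Rightarrow> 'b \<Rightarrow> nat \<Rightarrow> nat \<Rightarrow> 'b::comm_ring_1" where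
  "prefix_sum s v q y K h = subset_sum y h (grid_sum s v q K h)"

text \<open>Weight zero means no front columns: only the empty set of front rows survives.\<close>

lemma prefix_sum_0: "prefix_sum s v q 0 K h = grid_sum s v q K h {}"
proof -
  have "prefix_sum s v q 0 K h =
      (\<Sum>R\<in>Pow {..<h}. if R = {} then grid_sum s v q K h R else 0)"
    unfolding prefix_sum_def subset_sum_def
    by (intro sum.cong refl) (auto simp: power_0_left finite_subset card_eq_0_iff)
  thus ?thesis by (simp add: sum.delta)
qed

text \<open>The remainder has full height (\<open>merge_sum_eq\<close>) or a smaller one
  (\<open>merge_sum_top\<close>). In both cases the correction at the empty set is a grid sum
  without front rows, that is, a prefix sum with weight \<open>0\<close>.\<close>

lemma prefix_sum_Suc:
  fixes s v q y :: "'b::comm_ring_1"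
  assumes \<phi>: "\<phi> * (y + s + y * s) = y + y * s + q * s"
  defines "p \<equiv> y + s + y * s"
  shows "prefix_sum s v q y (Suc K) h =
    \<phi> * prefix_sum s v q p K h + (1 - \<phi>) * prefix_sum s v q 0 K h +
    (\<Sum>h0<h. v * ((1 + y) * s * \<phi> * (1 + p) ^ (h - 1 - h0) * prefix_sum s v q p K h0 +
      (s * (q + y) - (1 + y) * s * \<phi>) * prefix_sum s v q 0 K h0))"
proof -
  let ?g = "\<lambda>h0. grid_sum s v q K h0"
  let ?w = "pair_weight y s q"
  have "prefix_sum s v q y (Suc K) h = (\<Sum>Q\<in>Pow {..<h}. \<Sum>h0\<le>h. \<Sum>c\<in>columns h0 h.
      (if h0 < h then v else 1) * (?w Q c * ?g h0 (Q \<union> c)))"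
    unfolding prefix_sum_def subset_sum_def grid_sum_Suc sum_distrib_left pair_weight_def
    by (simp only: ac_simps)
  also have "\<dots> = (\<Sum>h0\<le>h. (if h0 < h then v else 1) *
      (\<Sum>Q\<in>Pow {..<h}. \<Sum>c\<in>columns h0 h. ?w Q c * ?g h0 (Q \<union> c)))"
    by (subst sum.swap) (simp only: sum_distrib_left)
  also have "{..h} = insert h {..<h}" by auto
  also have "(\<Sum>h0\<in>insert h {..<h}. (if h0 < h then v else 1) *
      (\<Sum>Q\<in>Pow {..<h}. \<Sum>c\<in>columns h0 h. ?w Q c * ?g h0 (Q \<union> c))) =
    merge_sum y s q h (?g h) + (\<Sum>h0<h. (if h0 < h then v else 1) *
      (\<Sum>Q\<in>Pow {..<h}. \<Sum>c\<in>columns h0 h. ?w Q c * ?g h0 (Q \<union> c)))"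
    by (simp add: merge_sum_def columns_def Pow_def)
  also have "merge_sum y s q h (?g h) = \<phi> * prefix_sum s v q p K h + (1 - \<phi>) * prefix_sum s v q 0 K h"
    unfolding merge_sum_eq[OF \<phi>] prefix_sum_0 by (simp add: p_def prefix_sum_def)
  also have "(\<Sum>h0<h. (if h0 < h then v else 1) *
      (\<Sum>Q\<in>Pow {..<h}. \<Sum>c\<in>columns h0 h. ?w Q c * ?g h0 (Q \<union> c))) =
    (\<Sum>h0<h. v * ((1 + y) * s * \<phi> * (1 + p) ^ (h - 1 - h0) * prefix_sum s v q p K h0 +
      (s * (q + y) - (1 + y) * s * \<phi>) * prefix_sum s v q 0 K h0))"
  proof (intro sum.cong refl)
    fix h0 assume "h0 \<in> {..<h}"
    \<comment> \<open>The column has to contain the top row \<open>h1 = h - 1\<close>, hence the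
      exponent \<open>h - 1 - h0\<close>.\<close>
    then obtain h1 where h: "h = Suc h1" "h0 \<le> h1" by (cases h) auto
    have inj: "inj_on (insert h1) (Pow {..<h1})"
      by (rule inj_onI) (metis Diff_insert_absorb PowD lessThan_iff order.irrefl subsetD)
    have "(\<Sum>Q\<in>Pow {..<h}. \<Sum>c\<in>columns h0 h. ?w Q c * ?g h0 (Q \<union> c)) =
        (\<Sum>Q\<in>Pow {..<Suc h1}. \<Sum>c\<in>Pow {..<h1}. ?w Q (insert h1 c) * ?g h0 (Q \<union> insert h1 c))"
      unfolding h(1) columns_Suc[OF h(2)] by (simp only: sum.reindex[OF inj] o_def)
    also have "\<dots> = (1 + y) * s * \<phi> * (1 + p) ^ (h1 - h0) * prefix_sum s v q p K h0 +
        (s * (q + y) - (1 + y) * s * \<phi>) * prefix_sum s v q 0 K h0"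
      unfolding p_def prefix_sum_0 unfolding prefix_sum_def
      by (rule merge_sum_top[OF \<phi> _ h(2)]) (rule grid_sum_above)
    finally show "(if h0 < h then v else 1) *
        (\<Sum>Q\<in>Pow {..<h}. \<Sum>c\<in>columns h0 h. ?w Q c * ?g h0 (Q \<union> c)) =
      v * ((1 + y) * s * \<phi> * (1 + p) ^ (h - 1 - h0) * prefix_sum s v q p K h0 +
        (s * (q + y) - (1 + y) * s * \<phi>) * prefix_sum s v q 0 K h0)"
      using \<open>h0 \<in> {..<h}\<close> h(1) by simp
  qed
  finally show ?thesis .
qed

subsection \<open>The recursion for power series\<close>

text \<open>In this and the following identities \<open>w\<close> and \<open>W\<close> stand for
  \<open>r ^ i\<close> and \<open>r ^ Suc i\<close>, \<open>P\<close> and \<open>R'\<close> for the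
  inverse of \<open>W\<close>, \<open>g\<close> for a geometric series, \<open>\<phi>\<close> for
  the factor ratio and \<open>\<tau>\<close> for \<open>t / (r ^ Suc i - 1)\<close>.\<close>

lemma step_identity:
  fixes x :: "'b::idom"
  assumes "(1 - P * x) * g = 1" "P * W = 1"
  shows "(1 + V * t * P * x * g) * (x - W) = x - W - x * V * t"
  using assms by algebra

lemma phi_identity:
  fixes r :: "'b::idom"
  assumes "\<phi> * (w * r - 1) = (1 - q * t) * w - 1" "\<tau> * (w * r - 1) = t" "r = 1 - t" "w * r \<noteq> 1"
  shows "1 - \<phi> = (q - 1) * w * \<tau>"
proof -
  have "(1 - \<phi>) * (w * r - 1) = (q - 1) * w * \<tau> * (w * r - 1)" using assms(1-3) by algebra
  thus ?thesis using assms(4) by simp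
qed

lemma beta_identity:
  fixes r :: "'b::idom"
  assumes "\<phi> * (w * r - 1) = (1 - q * t) * w - 1" "\<tau> * (w * r - 1) = t" "r = 1 - t" "w * r \<noteq> 1"
    and "s * r = t" "(1 + y) * w = 1" "r \<noteq> 0" "w \<noteq> 0"
  shows "s * (q + y) - (1 + y) * s * \<phi> = (q - 1) * \<tau> * (w - 1)"
proof -
  have "(s * (q + y) - (1 + y) * s * \<phi>) * (w * r) = (q - 1) * \<tau> * (w - 1) * (w * r)"
  proof -
    have "(s * (q + y) - (1 + y) * s * \<phi>) * (w * r) =
        (s * r) * (q * w + (1 + y) * w - w - (1 + y) * w * \<phi>)" by (simp add: algebra_simps)
    also have "\<dots> = t * (q * w + 1 - w - \<phi>)" unfolding assms(5,6) by simp
    also have "\<dots> = (q - 1) * \<tau> * (w - 1) * (w * r)"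
    proof -
      have "1 - \<phi> = (q - 1) * w * \<tau>" using phi_identity[OF assms(1-4)] .
      thus ?thesis using assms(2,3) by algebra
    qed
    finally show ?thesis .
  qed
  thus ?thesis using assms(7,8) by simp
qed

lemma merge_identity:
  fixes W :: "'b::comm_ring_1"
  assumes "\<phi> * (W - 1) = (1 - q * t) * w - 1" "R' * W = 1" "R' * w = R" "s = t * R"
  shows "\<phi> * (R' - 1) = R' - R + q * s"
proof -
  have "\<phi> * (R' - 1) = \<phi> * (R' - R' * W)" unfolding assms(2) ..
  also have "\<dots> = - R' * (\<phi> * (W - 1))" by (simp add: algebra_simps)
  also have "\<dots> = R' - (R' * w) + q * (t * (R' * w))"
    unfolding assms(1) by (simp add: algebra_simps)
  finally show ?thesis unfolding assms(3,4) .
qed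

lemma restart_identity:
  fixes x :: "'b::idom"
  assumes "1 - \<phi> = (Q - 1) * w * \<tau>" "\<beta> = (Q - 1) * \<tau> * (w - 1)" "(1 - x) * g = 1"
  shows "(1 - \<phi> + V * \<beta> * x * g) * (x - 1) = (Q - 1) * ((x - 1 - x * V) * w + x * V) * \<tau>"
  using assms by algebra

text \<open>Clearing \<open>x - w * r\<close> and \<open>x - 1\<close> leaves a polynomial identity.
  It shows that \<open>\<psi> + \<delta> - 1\<close>, which will be the constant part of a
  recursion, is a multiple of \<open>x\<close>.\<close>

lemma lead_identity:
  fixes x :: "'b::idom"
  assumes "1 - \<phi> = (Q - 1) * w * \<tau>" "\<tau> * (w * r - 1) = t" "r = 1 - t"
    and "\<psi> * (x - w * r) = \<phi> * (x - w * r - x * V * t)"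
    and "\<delta> * (x - 1) = (Q - 1) * ((x - 1 - x * V) * w + x * V) * \<tau>"
    and "a * (1 - x) * (x - w * r) = V * t * (Q * x - 1 + (1 - Q) * w)"
    and "x \<noteq> w * r" "x \<noteq> 1"
  shows "a * x = \<psi> + \<delta> - 1"
proof -
  have "(\<psi> + \<delta> - 1) * ((x - w * r) * (x - 1)) =
      \<phi> * (x - w * r - x * V * t) * (x - 1) +
      (Q - 1) * ((x - 1 - x * V) * w + x * V) * \<tau> * (x - w * r) - (x - w * r) * (x - 1)"
    using assms(4,5) by algebra
  also have "\<dots> = - (V * t * (Q * x - 1 + (1 - Q) * w)) * x"
    using assms(1-3) by algebra
  also have "\<dots> = a * x * ((x - w * r) * (x - 1))" using assms(6) by algebra
  finally show ?thesis using assms(7,8) by simp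
qed

section \<open>Specialization of the weights to powers of \<open>r\<close>\<close>

lemma r_t_nonzero: "(r_t :: 'a::field_char_0 fps) \<noteq> 0"
  using r_t_inverse[where 'a = 'a] by auto

lemma r_t_power_neq_1: "i \<ge> 1 \<Longrightarrow> (r_t ^ i :: 'a::field_char_0 fps) \<noteq> 1"
  using r_t_power_sub_1[of i, where 'a = 'a] by (metis diff_self fps_X_neq_zero fps_zero_nth mult_eq_0_iff)

lemma inverse_r_t_eq: "inverse r_t = (1 + s_t :: 'a::field_char_0 fps)"
proof -
  have "1 + s_t = inverse r_t * (r_t + fps_X :: 'a fps)"
    using r_t_inverse[where 'a = 'a] by (simp add: s_t_def distrib_left mult.commute)
  thus ?thesis by (simp add: r_t_def)
qed

lemma s_t_r_t: "s_t * r_t = (fps_X :: 'a::field_char_0 fps)"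
  by (simp only: s_t_def mult.assoc r_t_inverse mult_1_right)

lemma inverse_r_t_power: "inverse r_t ^ i * r_t ^ i = (1 :: 'a::field_char_0 fps)"
  by (simp only: power_mult_distrib[symmetric] r_t_inverse power_one)

text \<open>Since \<open>1 + s_t\<close> is the inverse of \<open>r_t\<close>, merging one more
  column raises \<open>i\<close> to \<open>Suc i\<close>, and the factor of the closed formula is
  the constant \<open>\<phi>\<close> of the merging lemmas.\<close>

lemma factor_ratio_merge:
  fixes q :: "'a::field_char_0" and i :: nat
  defines "y \<equiv> inverse r_t ^ i - 1 :: 'a fps"
  shows "y + s_t + y * s_t = inverse r_t ^ Suc i - 1"
    and "factor_ratio q (Suc i) * (y + s_t + y * s_t) = y + y * s_t + fps_const q * s_t"
proof -
  show p: "y + s_t + y * s_t = inverse r_t ^ Suc i - 1"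
    unfolding y_def power_Suc by (simp add: inverse_r_t_eq algebra_simps)
  have "factor_ratio q (Suc i) * (r_t ^ Suc i - 1) = (1 - fps_const q * fps_X) * r_t ^ i - 1"
    using r_t_divisions_exact(1)[of "Suc i" q] by simp
  moreover have "inverse r_t ^ Suc i * r_t ^ Suc i = (1 :: 'a fps)" by (rule inverse_r_t_power)
  moreover have "inverse r_t ^ Suc i * r_t ^ i = (inverse r_t :: 'a fps)"
    by (simp only: power_Suc mult.assoc inverse_r_t_power mult_1_right)
  moreover have "s_t = fps_X * (inverse r_t :: 'a fps)" by (rule s_t_def)
  ultimately have "factor_ratio q (Suc i) * (inverse r_t ^ Suc i - 1) =
      inverse r_t ^ Suc i - inverse r_t + fps_const q * s_t"
    by (rule merge_identity)
  also have "\<dots> = (y + s_t + y * s_t) - s_t + fps_const q * s_t"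
    unfolding p by (simp add: inverse_r_t_eq)
  finally show "factor_ratio q (Suc i) * (y + s_t + y * s_t) = y + y * s_t + fps_const q * s_t"
    unfolding p[symmetric] by (simp add: algebra_simps)
qed

text \<open>A row of \<open>i\<close> freely occupied front columns is nonempty with weight
  \<open>(1 + s_t) ^ i - 1\<close>, which is the weight used here.\<close>

definition grid_coeff :: "'a::field_char_0 \<Rightarrow> 'a \<Rightarrow> nat \<Rightarrow> nat \<Rightarrow> nat \<Rightarrow> 'a fps" where
  "grid_coeff v q i = prefix_sum s_t (fps_const v) (fps_const q) (inverse r_t ^ i - 1)"

lemma grid_coeff_no_rows: "grid_coeff v q i K 0 = 1"
proof -
  have "grid_sets K 0 = {{}}" by (auto simp: grid_sets_def)
  thus ?thesis
    by (simp add: grid_coeff_def prefix_sum_def subset_sum_def grid_sum_def ne_max_def below_def sw_min_def)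
qed

lemma grid_coeff_no_columns: "grid_coeff v q i 0 h = (if h = 0 then 1 else 0)"
proof (cases "h = 0")
  case False
  hence "grid_sets 0 h = {}" by (auto simp: grid_sets_def)
  thus ?thesis using False by (simp add: grid_coeff_def prefix_sum_def subset_sum_def grid_sum_def)
qed (simp add: grid_coeff_no_rows)

text \<open>The correction coefficient of \<open>merge_sum_top\<close>, for a remainder of smaller
  height.\<close>

definition beta :: "'a::field_char_0 \<Rightarrow> nat \<Rightarrow> 'a fps" where
  "beta q i = s_t * (fps_const q + (inverse r_t ^ i - 1)) -
     (1 + (inverse r_t ^ i - 1)) * s_t * factor_ratio q (Suc i)"

lemma grid_coeff_Suc:
  fixes v q :: "'a::field_char_0"
  shows "grid_coeff v q i (Suc K) h =
    factor_ratio q (Suc i) * grid_coeff v q (Suc i) K h +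
    (1 - factor_ratio q (Suc i)) * grid_coeff v q 0 K h +
    (\<Sum>h0<h. fps_const v * (fps_X * inverse r_t ^ Suc i * factor_ratio q (Suc i) *
        (inverse r_t ^ Suc i) ^ (h - 1 - h0) * grid_coeff v q (Suc i) K h0 +
      beta q i * grid_coeff v q 0 K h0))"
proof -
  have e1: "inverse r_t ^ i * s_t = fps_X * (inverse r_t ^ Suc i :: 'a fps)"
    unfolding s_t_def power_Suc by (simp add: ac_simps)
  have e2: "1 + (c - 1) = c" "c ^ 0 - 1 = 0" for c :: "'a fps" by simp_all
  show ?thesis
    unfolding grid_coeff_def beta_def prefix_sum_Suc[OF factor_ratio_merge(2)] factor_ratio_merge(1)
    unfolding e2 e1 ..
qed

section \<open>Generating functions in the numbers of columns and rows\<close>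

text \<open>This is \<open>1 / (1 - c x)\<close>. It performs the sum over the height of the
  remainder, the powers of \<open>c\<close> coming from the ignored rows.\<close>

definition geo :: "'b::comm_ring_1 \<Rightarrow> 'b fps" where "geo c = Abs_fps (\<lambda>n. c ^ n)"

lemma geo_eq: "(1 - fps_const c * fps_X) * geo c = 1"
proof (rule fps_ext)
  fix n show "((1 - fps_const c * fps_X) * geo c) $ n = 1 $ n"
    by (cases n) (simp_all add: geo_def left_diff_distrib mult.assoc)
qed

lemma X_geo_mult_nth: "(fps_X * geo c * A) $ h = (\<Sum>h0<h. c ^ (h - 1 - h0) * A $ h0)"
proof (cases h)
  case (Suc h1)
  have "(fps_X * geo c * A) $ h = (fps_X * (A * geo c)) $ h" by (simp only: ac_simps)
  also have "\<dots> = (A * geo c) $ h1" by (simp add: Suc)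
  also have "\<dots> = (\<Sum>h0<h. c ^ (h - 1 - h0) * A $ h0)"
    unfolding fps_mult_nth Suc by (simp add: geo_def mult.commute lessThan_Suc_atMost atMost_atLeast0)
  finally show ?thesis .
qed (simp add: mult.assoc)

text \<open>The multiplier for passing from \<open>i\<close> to \<open>Suc i\<close> front columns:
  the summand \<open>1\<close> belongs to remainders of full height, the geometric series to lower
  ones.\<close>

definition step_factor :: "'a::field_char_0 \<Rightarrow> 'a \<Rightarrow> nat \<Rightarrow> 'a fps3" where
  "step_factor v q i = const_t (factor_ratio q (Suc i)) * (1 + const_K v * var_t *
     const_t (inverse r_t ^ Suc i) * var_x * fps_const (geo (inverse r_t ^ Suc i)))"

text \<open>The corresponding multiplier for the return to no front columns.\<close>

definition restart_factor :: "'a::field_char_0 \<Rightarrow> 'a \<Rightarrow> nat \<Rightarrow> 'a fps3" where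
  "restart_factor v q i = 1 - const_t (factor_ratio q (Suc i)) +
     const_K v * const_t (beta q i) * var_x * fps_const (geo 1)"

definition grid_series :: "'a::field_char_0 \<Rightarrow> 'a \<Rightarrow> nat \<Rightarrow> 'a fps3" where
  "grid_series v q i = Abs_fps (\<lambda>K. Abs_fps (\<lambda>h. grid_coeff v q i K h))"

text \<open>The recursion for \<open>grid_coeff\<close>, in which the sums over \<open>h0\<close>
  have become products with geometric series. The summand \<open>1\<close> is the case of no
  columns, where only the empty set of height \<open>0\<close> exists.\<close>

lemma grid_series_eq:
  "grid_series v q i = 1 + var_u * (step_factor v q i * grid_series v q (Suc i) + restart_factor v q i * grid_series v q 0)"
proof (rule fps_ext)
  fix K
  let ?\<phi> = "factor_ratio q (Suc i)" and ?R = "inverse r_t ^ Suc i :: 'a fps"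
  define F where "F i K = Abs_fps (\<lambda>h. grid_coeff v q i K h)" for i K
  define \<psi> where "\<psi> = fps_const ?\<phi> * (1 + fps_const (fps_const v) * fps_const fps_X * fps_const ?R * fps_X * geo ?R)"
  define \<delta> where "\<delta> = 1 - fps_const ?\<phi> + fps_const (fps_const v) * fps_const (beta q i) * fps_X * geo 1"
  have psi: "step_factor v q i = fps_const \<psi>" and del: "restart_factor v q i = fps_const \<delta>"
    unfolding step_factor_def restart_factor_def \<psi>_def \<delta>_def const_K_def const_t_def var_t_def var_x_def
    by (simp_all only: fps_const_mult[symmetric] fps_const_add[symmetric] fps_const_sub[symmetric] fps_const_1_eq_1)
  have Suc: "F i (Suc K) = \<psi> * F (Suc i) K + \<delta> * F 0 K" for K
  proof (rule fps_ext)
    fix h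
    have "\<psi> * F (Suc i) K + \<delta> * F 0 K = fps_const ?\<phi> * F (Suc i) K + fps_const (1 - ?\<phi>) * F 0 K +
        (fps_const (fps_const v * (fps_X * ?R * ?\<phi>)) * (fps_X * geo ?R * F (Suc i) K) +
         fps_const (fps_const v * beta q i) * (fps_X * geo 1 * F 0 K))"
      unfolding \<psi>_def \<delta>_def
      by (simp only: fps_const_mult[symmetric] fps_const_sub[symmetric] fps_const_1_eq_1) algebra
    hence "(\<psi> * F (Suc i) K + \<delta> * F 0 K) $ h =
        ?\<phi> * grid_coeff v q (Suc i) K h + (1 - ?\<phi>) * grid_coeff v q 0 K h +
        (fps_const v * (fps_X * ?R * ?\<phi>) * (\<Sum>h0<h. ?R ^ (h - 1 - h0) * grid_coeff v q (Suc i) K h0) +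
         fps_const v * beta q i * (\<Sum>h0<h. 1 ^ (h - 1 - h0) * grid_coeff v q 0 K h0))"
      by (simp only: fps_add_nth fps_mult_left_const_nth X_geo_mult_nth) (simp only: F_def fps_nth_Abs_fps)
    also have "\<dots> = grid_coeff v q i (Suc K) h"
      unfolding grid_coeff_Suc sum_distrib_left distrib_left sum.distrib power_one mult_1_left
      by (simp only: ac_simps)
    finally show "F i (Suc K) $ h = (\<psi> * F (Suc i) K + \<delta> * F 0 K) $ h" by (simp add: F_def)
  qed
  have zero: "F i 0 = 1" by (rule fps_ext) (simp add: F_def grid_coeff_no_columns)
  have nth: "grid_series v q i $ K = F i K" for i K by (simp add: grid_series_def F_def)
  show "grid_series v q i $ K =
      (1 + var_u * (step_factor v q i * grid_series v q (Suc i) + restart_factor v q i * grid_series v q 0)) $ K"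
    unfolding psi del var_u_def
    by (cases K) (simp_all add: nth zero Suc)
qed

text \<open>The difference in the number of columns selects the sets that meet the last column; the
  index \<open>Suc l\<close> guarantees a nonempty top row.\<close>

definition perm_series :: "'a::field_char_0 \<Rightarrow> 'a \<Rightarrow> nat \<Rightarrow> 'a fps3" where
  "perm_series v q i =
     Abs_fps (\<lambda>k. Abs_fps (\<lambda>l. grid_coeff v q i (Suc k) (Suc l) - grid_coeff v q i k (Suc l)))"

text \<open>In \<open>grid_series\<close> the part with no rows is \<open>1 / (1 - u)\<close> and
  the part with no columns is \<open>1\<close>, so the right-hand side has no terms free of
  \<open>u\<close> or of \<open>x\<close>.\<close>

lemma perm_series_grid_series:
  "var_u * (var_x * perm_series v q i) = (1 - var_u) * grid_series v q i - 1"
proof (rule fps_ext, rule fps_ext)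
  fix k l
  show "(var_u * (var_x * perm_series v q i)) $ k $ l = ((1 - var_u) * grid_series v q i - 1) $ k $ l"
    by (cases k; cases l)
      (simp_all add: var_u_def var_x_def perm_series_def grid_series_def left_diff_distrib
        grid_coeff_no_rows grid_coeff_no_columns)
qed

lemma gen_fun_eq_perm_series:
  "gen_fun var_t var_x var_u (const_K v) (const_K q) 1 = perm_series v q 0"
proof (rule fps_ext, rule fps_ext)
  fix k l
  let ?w = "\<lambda>S. s_t ^ card S * fps_const v ^ card (ne_max S) * fps_const q ^ card (below {} S)"
  have sub: "grid_sets k (Suc l) \<subseteq> grid_sets (Suc k) (Suc l)" by (auto simp: grid_sets_def)
  have boxed: "boxed_sets k l = grid_sets (Suc k) (Suc l) - grid_sets k (Suc l)"
  proof -
    have "k \<in> fst ` S \<longleftrightarrow> \<not> S \<subseteq> {..<k} \<times> {..l}" if "S \<subseteq> {..k} \<times> {..l}" for S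
    proof
      assume "\<not> S \<subseteq> {..<k} \<times> {..l}"
      then obtain p where "p \<in> S" "p \<notin> {..<k} \<times> {..l}" by blast
      hence "p \<in> S" "fst p = k" using that by fastforce+
      thus "k \<in> fst ` S" by force
    qed auto
    thus ?thesis unfolding boxed_sets_def grid_sets_def lessThan_Suc_atMost by auto
  qed
  have "perm_series v q 0 $ k $ l = (\<Sum>S\<in>boxed_sets k l. ?w S)"
    unfolding boxed by (simp add: perm_series_def grid_coeff_def prefix_sum_0 grid_sum_def
        sum_diff[OF finite_grid_sets sub])
  also have "\<dots> = (\<Sum>S\<in>boxed_sets k l. fps_const (cell_weight v q S) * s_t ^ card S)"
    by (rule sum.cong) (simp_all add: cell_weight_def below_def fps_const_mult[symmetric]
        fps_const_power[symmetric] ac_simps del: fps_const_mult fps_const_power)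
  finally show "gen_fun var_t var_x var_u (const_K v) (const_K q) 1 $ k $ l = perm_series v q 0 $ k $ l"
    unfolding gen_fun_nth by simp
qed

lemma const_t_diff: "const_t (a - b) = const_t a - const_t (b :: 'a::field_char_0 fps)"
  and const_t_mult: "const_t (a * b) = const_t a * const_t b"
  and const_t_1: "const_t (1 :: 'a fps) = 1"
  by (simp_all add: const_t_def)

section \<open>Closed forms of the multipliers and iteration of the recursion\<close>

context
  fixes v q :: "'a::field_char_0"
begin

text \<open>Up to \<open>var_u\<close>, this identifies the multiplier with the factor of index
  \<open>Suc i\<close> of the product in the closed formula.\<close>

lemma step_factor_eq:
  "step_factor v q i * (var_x - r_series ^ Suc i) =
    const_t (factor_ratio q (Suc i)) * (var_x - r_series ^ Suc i - var_x * const_K v * var_t)"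
proof -
  let ?P = "const_t (inverse r_t ^ Suc i) :: 'a fps3"
  let ?g = "fps_const (geo (inverse r_t ^ Suc i)) :: 'a fps3"
  have "(1 - ?P * var_x) * ?g = fps_const ((1 - fps_const (inverse r_t ^ Suc i) * fps_X) * geo (inverse r_t ^ Suc i))"
    unfolding const_t_def var_x_def
    by (simp only: fps_const_mult[symmetric] fps_const_sub[symmetric] fps_const_1_eq_1)
  also have "\<dots> = 1" unfolding geo_eq by (rule fps_const_1_eq_1)
  finally have "(1 - ?P * var_x) * ?g = 1" .
  moreover have "?P * r_series ^ Suc i = 1"
    unfolding r_series_power_eq const_t_mult[symmetric] inverse_r_t_power by (rule const_t_1)
  ultimately show ?thesis
    unfolding step_factor_def mult.assoc[of "const_t (factor_ratio q (Suc i))"]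
    by (simp only: step_identity)
qed

abbreviation (input) tau :: "nat \<Rightarrow> 'a fps" where "tau i \<equiv> fps_X / (r_t ^ Suc i - 1)"

lemma tau_eq:
  "factor_ratio q (Suc i) * (r_t ^ i * r_t - 1) = (1 - fps_const q * fps_X) * r_t ^ i - 1"
  "tau i * (r_t ^ i * r_t - 1) = fps_X" "r_t = (1 - fps_X :: 'a fps)" "r_t ^ i * r_t \<noteq> (1 :: 'a fps)"
  using r_t_divisions_exact[of "Suc i"] r_t_power_neq_1[of "Suc i", where 'a = 'a]
  by (simp_all add: r_t_def mult.commute)

text \<open>The correction merely repairs the marking of the minimum in the lowest row, which is why
  it carries a factor \<open>q - 1\<close>.\<close>

lemma factor_ratio_eq:
  "1 - factor_ratio q (Suc i) = (fps_const q - 1) * r_t ^ i * tau i"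
  by (rule phi_identity[OF tau_eq])

lemma beta_eq: "beta q i = (fps_const q - 1) * tau i * (r_t ^ i - 1)"
  unfolding beta_def
proof (rule beta_identity[OF tau_eq s_t_r_t _ r_t_nonzero])
  show "(1 + (inverse r_t ^ i - 1)) * r_t ^ i = (1 :: 'a fps)"
    using inverse_r_t_power[of i, where 'a = 'a] by simp
  show "r_t ^ i \<noteq> (0 :: 'a fps)" using r_t_nonzero[where 'a = 'a] by simp
qed

lemma restart_factor_eq:
  "restart_factor v q i * (var_x - 1) =
    (const_K q - 1) * ((var_x - 1 - var_x * const_K v) * r_series ^ i + var_x * const_K v) * const_t (tau i)"
proof -
  let ?g = "fps_const (geo 1) :: 'a fps3"
  have "(1 - var_x) * ?g = fps_const ((1 - fps_const 1 * fps_X) * geo 1)"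
    unfolding var_x_def
    by (simp only: fps_const_mult[symmetric] fps_const_sub[symmetric] fps_const_1_eq_1 mult_1_left)
  also have "\<dots> = 1" unfolding geo_eq by (rule fps_const_1_eq_1)
  finally have g: "(1 - var_x) * ?g = 1" .
  have "1 - const_t (factor_ratio q (Suc i)) = (const_K q - 1) * r_series ^ i * const_t (tau i)"
    unfolding r_series_power_eq const_K_def const_t_1[symmetric] const_t_diff[symmetric]
      const_t_mult[symmetric] factor_ratio_eq by (simp only: fps_const_1_eq_1)
  moreover have "const_t (beta q i) = (const_K q - 1) * const_t (tau i) * (r_series ^ i - 1)"
    unfolding r_series_power_eq const_K_def const_t_1[symmetric] const_t_diff[symmetric]
      const_t_mult[symmetric] beta_eq by (simp only: fps_const_1_eq_1)
  ultimately show ?thesis unfolding restart_factor_def using g by (rule restart_identity)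
qed

text \<open>The inhomogeneous term of the recursion for \<open>perm_series\<close>: a summand of the
  numerator with its prefactor but without its product.\<close>

definition lead_term :: "nat \<Rightarrow> 'a fps3" where
  "lead_term i = const_K v * var_t / (1 - var_x) *
     ((const_K q * var_x - 1 + (1 - const_K q) * r_series ^ i) / (var_x - r_series ^ Suc i))"

lemma lead_term_eq: "lead_term i * var_x = step_factor v q i + restart_factor v q i - 1"
proof (rule lead_identity)
  have nz: "(1 - var_x :: 'a fps3) $ 0 $ 0 $ 0 \<noteq> 0" "(var_x - r_series ^ Suc i :: 'a fps3) $ 0 $ 0 $ 0 \<noteq> 0"
    by (rule fps3_denominators_nonzero)+
  have "lead_term i * (1 - var_x) * (var_x - r_series ^ Suc i) =
      (const_K v * var_t / (1 - var_x) * (1 - var_x)) *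
      ((const_K q * var_x - 1 + (1 - const_K q) * r_series ^ i) / (var_x - r_series ^ Suc i) *
        (var_x - r_series ^ Suc i))"
    unfolding lead_term_def by (simp only: ac_simps)
  thus "lead_term i * (1 - var_x) * (var_x - r_series ^ i * r_series) =
      const_K v * var_t * (const_K q * var_x - 1 + (1 - const_K q) * r_series ^ i)"
    unfolding fps3_divide_mult[OF nz(1)] fps3_divide_mult[OF nz(2)] by (simp only: power_Suc2)
  show "step_factor v q i * (var_x - r_series ^ i * r_series) = const_t (factor_ratio q (Suc i)) *
      (var_x - r_series ^ i * r_series - var_x * const_K v * var_t)"
    using step_factor_eq[of i] by (simp only: power_Suc2)
  show "restart_factor v q i * (var_x - 1) = (const_K q - 1) *
      ((var_x - 1 - var_x * const_K v) * r_series ^ i + var_x * const_K v) * const_t (tau i)"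
    by (rule restart_factor_eq)
  show "1 - const_t (factor_ratio q (Suc i)) = (const_K q - 1) * r_series ^ i * const_t (tau i)"
    unfolding r_series_power_eq const_K_def const_t_1[symmetric] const_t_diff[symmetric]
      const_t_mult[symmetric] factor_ratio_eq by (simp only: fps_const_1_eq_1)
  show "const_t (tau i) * (r_series ^ i * r_series - 1) = var_t"
    unfolding power_Suc2[symmetric]
    unfolding r_series_power_eq var_t_def const_t_1[symmetric] const_t_diff[symmetric] const_t_mult[symmetric]
    using tau_eq(2)[of i] by (simp only: power_Suc2)
  show "r_series = (1 :: 'a fps3) - var_t" by (rule r_series_def)
  show "var_x \<noteq> r_series ^ i * (r_series :: 'a fps3)"
    using nz(2) unfolding power_Suc2 by (metis diff_self fps_zero_nth)
  show "var_x \<noteq> (1 :: 'a fps3)" using nz(1) by auto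
qed

text \<open>Multiply the recursion for \<open>grid_series\<close> by \<open>1 - var_u\<close> and
  replace each series by \<open>1 + var_u * var_x * perm_series v q j\<close>. The constants collect
  to \<open>var_u * (step_factor v q i + restart_factor v q i - 1)\<close>, which by
  \<open>lead_term_eq\<close> is divisible by \<open>var_u * var_x\<close>.\<close>

lemma perm_series_eq:
  "perm_series v q i = lead_term i + var_u * step_factor v q i * perm_series v q (Suc i) +
     var_u * restart_factor v q i * perm_series v q 0"
proof -
  let ?G = "perm_series v q" and ?A = "grid_series v q"
  have "var_u * var_x * ?G i = (1 - var_u) * ?A i - 1"
    using perm_series_grid_series[of v q i] by (simp only: mult.assoc)
  moreover have "var_u * var_x * ?G (Suc i) = (1 - var_u) * ?A (Suc i) - 1"
    using perm_series_grid_series[of v q "Suc i"] by (simp only: mult.assoc)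
  moreover have "var_u * var_x * ?G 0 = (1 - var_u) * ?A 0 - 1"
    using perm_series_grid_series[of v q 0] by (simp only: mult.assoc)
  ultimately have "var_u * var_x * ?G i = var_u * var_x *
      (lead_term i + var_u * step_factor v q i * ?G (Suc i) + var_u * restart_factor v q i * ?G 0)"
    using grid_series_eq[of v q i] lead_term_eq[of i] by algebra
  moreover have "var_u * var_x \<noteq> (0 :: 'a fps3)" by (simp add: var_u_def var_x_def)
  ultimately show ?thesis by simp
qed

lemma partial_product_Suc:
  "partial_product v q (Suc (Suc i)) = partial_product v q (Suc i) * (var_u * step_factor v q i)"
proof -
  have "{1..Suc (Suc i) - 1} = insert (Suc i) {1..Suc i - 1}" by auto
  moreover have "var_u * (var_x - r_series ^ Suc i - var_x * const_K v * var_t) *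
      const_t (factor_ratio q (Suc i)) / (var_x - r_series ^ Suc i) = var_u * step_factor v q i"
    by (rule fps_divide_eqI[OF fps3_denominators_nonzero(5)]) (simp only: mult.assoc step_factor_eq mult.left_commute mult.commute)
  ultimately show ?thesis unfolding partial_product_def by (simp add: mult.commute)
qed

lemma partial_product_1: "partial_product v q (Suc 0) = 1"
  by (simp add: partial_product_def)

definition num_factor :: "'a fps3" where
  "num_factor = const_K v * var_t / (1 - var_x)"

definition den_factor :: "'a fps3" where
  "den_factor = var_u * (const_K q - 1) / (var_x - 1)"

lemma numerator_term_eq:
  "num_factor * numerator_term v q (Suc i) = partial_product v q (Suc i) * lead_term i"
  unfolding num_factor_def numerator_term_def lead_term_def diff_Suc_1 by (simp only: ac_simps)

lemma denominator_term_eq: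
  "den_factor * denominator_term v q (Suc i) = partial_product v q (Suc i) * (var_u * restart_factor v q i)"
proof -
  let ?B = "((var_x - 1 - var_x * const_K v) * r_series ^ i + var_x * const_K v) * const_t (tau i)"
  have "den_factor = var_u * (const_K q - 1) / (var_x - 1)" by (rule den_factor_def)
  hence d: "den_factor * (var_x - 1) = var_u * (const_K q - 1)"
    using fps3_divide_mult[OF fps3_denominators_nonzero(3)] by simp
  have "(var_x - 1) * (den_factor * ?B) = den_factor * (var_x - 1) * ?B" by (simp only: ac_simps)
  also have "\<dots> = var_u * (restart_factor v q i * (var_x - 1))" unfolding d restart_factor_eq by (simp only: ac_simps)
  finally have "(var_x - 1) * (den_factor * ?B) = (var_x - 1) * (var_u * restart_factor v q i)"
    by (simp only: ac_simps)
  moreover have "(var_x - 1 :: 'a fps3) \<noteq> 0" using fps3_denominators_nonzero(3)[where 'a = 'a] by auto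
  ultimately have "den_factor * ?B = var_u * restart_factor v q i" by simp
  moreover have "den_factor * denominator_term v q (Suc i) = partial_product v q (Suc i) * (den_factor * ?B)"
    unfolding denominator_term_def diff_Suc_1 by (simp only: ac_simps)
  ultimately show ?thesis by (simp only:)
qed

text \<open>Each application of the recursion yields a numerator summand and a multiple of the
  unknown series at \<open>0\<close>, both weighted by the product of the step factors used so
  far.\<close>

lemma perm_series_unroll:
  "perm_series v q 0 =
    (\<Sum>n=1..m. num_factor * numerator_term v q n + den_factor * denominator_term v q n * perm_series v q 0) +
    partial_product v q (Suc m) * perm_series v q m"
proof (induction m)
  case 0
  show ?case by (simp add: partial_product_1)
next
  case (Suc m)
  have "partial_product v q (Suc m) * perm_series v q m =
      num_factor * numerator_term v q (Suc m) +
      den_factor * denominator_term v q (Suc m) * perm_series v q 0 +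
      partial_product v q (Suc (Suc m)) * perm_series v q (Suc m)"
    unfolding numerator_term_eq denominator_term_eq partial_product_Suc
    by (subst perm_series_eq[of m]) (simp only: distrib_left ac_simps)
  thus ?case using Suc by (simp add: add.assoc)
qed

end

section \<open>Passage to the infinite sums\<close>

lemma fps_mult_nth_cong:
  "(\<And>j. j \<le> k \<Longrightarrow> A $ j = B $ j) \<Longrightarrow> (C * A) $ k = (C * B) $ k"
  unfolding fps_mult_nth by (intro sum.cong) auto

lemma var_u_power_dvd_nth:
  fixes F :: "'a::field_char_0 fps3"
  assumes "var_u ^ m dvd F" "k < m"
  shows "F $ k = 0"
proof -
  obtain g where "F = var_u ^ m * g" using assms(1) by (elim dvdE)
  thus ?thesis using assms(2) by (simp add: var_u_def fps_X_power_mult_nth)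
qed

lemma fps3_infsum_nth:
  fixes F :: "nat \<Rightarrow> 'a::field_char_0 fps3"
  assumes "\<And>n. n \<ge> 1 \<Longrightarrow> var_u ^ (n - 1) dvd F n" "k < m"
  shows "fps3_infsum F {1..} $ k = (\<Sum>n=1..m. F n) $ k"
proof (rule fps_ext, rule fps_ext)
  fix j i
  have "F n $ k = 0" if "n \<ge> 1" "\<not> n \<le> m" for n
    by (rule var_u_power_dvd_nth[OF assms(1)]) (use that assms(2) in auto)
  hence sub: "{n \<in> {1..}. F n $ k $ j $ i \<noteq> 0} \<subseteq> {1..m}" by force
  have "fps3_infsum F {1..} $ k $ j $ i = (\<Sum>n\<in>{n \<in> {1..}. F n $ k $ j $ i \<noteq> 0}. F n $ k $ j $ i)"
    by (simp add: fps3_infsum_def)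
  also have "\<dots> = (\<Sum>n=1..m. F n $ k $ j $ i)"
    by (rule sum.mono_neutral_left) (use sub in auto)
  finally show "fps3_infsum F {1..} $ k $ j $ i = (\<Sum>n=1..m. F n) $ k $ j $ i"
    by (simp add: fps_sum_nth)
qed

text \<open>For the coefficient of \<open>u ^ k\<close> the recursion is unrolled
  \<open>Suc k\<close> times: the remainder and all further summands are divisible by
  \<open>u ^ Suc k\<close>.\<close>

lemma perm_series_fixed_point:
  fixes v q :: "'a::field_char_0"
  shows "perm_series v q 0 =
    num_factor v * fps3_infsum (numerator_term v q) {1..} +
    den_factor q * fps3_infsum (denominator_term v q) {1..} * perm_series v q 0"
proof (rule fps_ext)
  fix k
  let ?m = "Suc k" and ?G = "perm_series v q 0"
  have N: "var_u ^ (n - 1) dvd numerator_term v q n" for n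
    unfolding numerator_term_def by (rule dvd_mult) (rule var_u_power_dvd_partial_product)
  have D: "var_u ^ (n - 1) dvd denominator_term v q n" for n
    unfolding denominator_term_def by (rule dvd_mult) (rule var_u_power_dvd_partial_product)
  have "var_u ^ ?m dvd partial_product v q (Suc ?m) * perm_series v q ?m"
    using var_u_power_dvd_partial_product[of "Suc ?m" v q] by (simp only: diff_Suc_1 dvd_mult2)
  hence tail: "(partial_product v q (Suc ?m) * perm_series v q ?m) $ k = 0"
    by (rule var_u_power_dvd_nth) simp
  have num: "(num_factor v * fps3_infsum (numerator_term v q) {1..}) $ k =
      (num_factor v * (\<Sum>n=1..?m. numerator_term v q n)) $ k"
    by (rule fps_mult_nth_cong) (rule fps3_infsum_nth, rule N, simp)
  have "(den_factor q * ?G * fps3_infsum (denominator_term v q) {1..}) $ k =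
      (den_factor q * ?G * (\<Sum>n=1..?m. denominator_term v q n)) $ k"
    by (rule fps_mult_nth_cong) (rule fps3_infsum_nth, rule D, simp)
  hence den: "(den_factor q * fps3_infsum (denominator_term v q) {1..} * ?G) $ k =
      (den_factor q * (\<Sum>n=1..?m. denominator_term v q n) * ?G) $ k"
    by (simp only: ac_simps)
  have "?G $ k = (num_factor v * (\<Sum>n=1..?m. numerator_term v q n) +
      den_factor q * (\<Sum>n=1..?m. denominator_term v q n) * ?G) $ k"
    using arg_cong[OF perm_series_unroll[of v q ?m], of "\<lambda>F. F $ k"] tail
    by (simp only: sum.distrib sum_distrib_left sum_distrib_right fps_add_nth add_0_right)
  thus "?G $ k = (num_factor v * fps3_infsum (numerator_term v q) {1..} +
      den_factor q * fps3_infsum (denominator_term v q) {1..} * ?G) $ k"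
    by (simp only: fps_add_nth num den)
qed

text \<open>The fixed-point equation is linear in the unknown series, and its coefficient is a unit
  because the second sum carries a factor \<open>u\<close>.\<close>

lemma gen_fun_formula:
  fixes v q :: "'a::field_char_0"
  shows "gen_fun var_t var_x var_u (const_K v) (const_K q) 1 =
    const_K v * var_t / (1 - var_x) * fps3_infsum (numerator_term v q) {1..} *
    inverse (1 - var_u * (const_K q - 1) / (var_x - 1) * fps3_infsum (denominator_term v q) {1..})"
proof -
  let ?G = "perm_series v q 0" and ?N = "fps3_infsum (numerator_term v q) {1..}"
  let ?D = "1 - var_u * (const_K q - 1) / (var_x - 1) * fps3_infsum (denominator_term v q) {1..}"
  have "?D * inverse ?D = 1"
    by (rule fps3_mult_inverse) (rule fps3_denominators_nonzero)
  hence "?G = ?G * ?D * inverse ?D" by (simp only: mult.assoc mult_1_right)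
  also have "?G * ?D = const_K v * var_t / (1 - var_x) * ?N"
    using perm_series_fixed_point[of v q] unfolding num_factor_def den_factor_def
    by (simp add: algebra_simps)
  finally show ?thesis unfolding gen_fun_eq_perm_series .
qed

subsection \<open>Symmetries\<close>

text \<open>The half turn of the graph of a permutation.\<close>

definition rev_compl :: "nat \<Rightarrow> (nat \<Rightarrow> nat) \<Rightarrow> nat \<Rightarrow> nat" where
  "rev_compl n \<pi> i = (if i \<in> {1..n} then Suc n - \<pi> (Suc n - i) else i)"

lemma perms_range: "\<pi> \<in> perms n \<Longrightarrow> i \<in> {1..n} \<Longrightarrow> \<pi> i \<in> {1..n}"
  unfolding perms_def mem_Collect_eq by (rule permutes_in_image[THEN iffD2])

lemma reflect_range: "i \<in> {1..n} \<Longrightarrow> Suc n - i \<in> {1..n}" for i n :: nat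
  by auto

lemma rev_compl_involution:
  assumes "\<pi> \<in> perms n"
  shows "rev_compl n (rev_compl n \<pi>) = \<pi>"
proof
  fix i
  show "rev_compl n (rev_compl n \<pi>) i = \<pi> i"
  proof (cases "i \<in> {1..n}")
    case True
    thus ?thesis using perms_range[OF assms True] by (auto simp: rev_compl_def)
  next
    case False
    thus ?thesis using assms by (auto simp: rev_compl_def perms_def permutes_not_in)
  qed
qed

lemma rev_compl_perms:
  assumes "\<pi> \<in> perms n"
  shows "rev_compl n \<pi> \<in> perms n"
  unfolding perms_def mem_Collect_eq
proof (rule bij_imp_permutes)
  have range: "rev_compl n \<pi> i \<in> {1..n}" if "i \<in> {1..n}" for i
    using perms_range[OF assms reflect_range[OF that]] that by (auto simp: rev_compl_def)
  have "inj_on (rev_compl n \<pi>) {1..n}"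
  proof (rule inj_onI)
    fix i j assume ij: "i \<in> {1..n}" "j \<in> {1..n}" "rev_compl n \<pi> i = rev_compl n \<pi> j"
    have "Suc n - \<pi> (Suc n - i) = Suc n - \<pi> (Suc n - j)" using ij by (simp add: rev_compl_def)
    hence "\<pi> (Suc n - i) = \<pi> (Suc n - j)"
      using perms_range[OF assms reflect_range[OF ij(1)]] perms_range[OF assms reflect_range[OF ij(2)]]
      unfolding atLeastAtMost_iff by linarith
    hence "Suc n - i = Suc n - j"
      using permutes_inj[of \<pi> "{1..n}"] assms by (simp add: perms_def inj_eq)
    thus "i = j" using ij by auto
  qed
  moreover have "rev_compl n \<pi> ` {1..n} \<subseteq> {1..n}" using range by blast
  ultimately show "bij_betw (rev_compl n \<pi>) {1..n} {1..n}"
    by (simp add: bij_betw_def endo_inj_surj)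
qed (auto simp: rev_compl_def)

lemma bij_betw_rev_compl: "bij_betw (rev_compl n) (perms n) (perms n)"
  by (rule bij_betw_byWitness[where f' = "rev_compl n"])
    (auto simp: rev_compl_involution intro: rev_compl_perms)

lemma inv_rev_compl:
  assumes "\<pi> \<in> perms n"
  shows "inv (rev_compl n \<pi>) = rev_compl n (inv \<pi>)"
proof (rule inv_unique_comp)
  have \<pi>: "\<pi> permutes {1..n}" using assms by (simp add: perms_def)
  have inv: "inv \<pi> \<in> perms n" using permutes_inv[OF \<pi>] by (simp add: perms_def)
  \<comment> \<open>Stated for any one-sided inverse pair, so that it serves both
    compositions.\<close>
  have *: "rev_compl n \<sigma> (rev_compl n \<tau> i) = i"
    if "\<sigma> \<in> perms n" "\<tau> \<in> perms n" "\<And>i. \<sigma> (\<tau> i) = i" for \<sigma> \<tau> i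
  proof (cases "i \<in> {1..n}")
    case True
    let ?j = "\<tau> (Suc n - i)"
    have "?j \<in> {1..n}" using perms_range[OF that(2) reflect_range[OF True]] .
    moreover from this have "Suc n - (Suc n - ?j) = ?j" by auto
    ultimately have "rev_compl n \<sigma> (rev_compl n \<tau> i) = Suc n - \<sigma> ?j"
      using True reflect_range[of ?j n] by (simp only: rev_compl_def if_True)
    thus ?thesis using that(3)[of "Suc n - i"] True by auto
  qed (simp only: rev_compl_def if_False)
  show "rev_compl n \<pi> \<circ> rev_compl n (inv \<pi>) = id"
    using *[OF assms inv] permutes_inverses(1)[OF \<pi>] by (simp add: fun_eq_iff)
  show "rev_compl n (inv \<pi>) \<circ> rev_compl n \<pi> = id"
    using *[OF inv assms] permutes_inverses(2)[OF \<pi>] by (simp add: fun_eq_iff)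
qed

text \<open>Reversal and complementation each exchange ascents and descents, so their composition
  moves a descent at \<open>n - i\<close> to \<open>i\<close>.\<close>

lemma des_rev_compl:
  assumes "\<pi> \<in> perms n"
  shows "des n (rev_compl n \<pi>) = des n \<pi>"
proof -
  have "bij_betw (\<lambda>i. n - i) {i \<in> {1..n - 1}. rev_compl n \<pi> i > rev_compl n \<pi> (i + 1)}
      {i \<in> {1..n - 1}. \<pi> i > \<pi> (i + 1)}"
  proof (rule bij_betw_byWitness[where f' = "\<lambda>i. n - i"])
    have iff: "rev_compl n \<pi> i > rev_compl n \<pi> (i + 1) \<longleftrightarrow> \<pi> (n - i) > \<pi> (n - i + 1)"
      if "i \<in> {1..n - 1}" for i
    proof -
      have mem: "n - i \<in> {1..n}" "n - i + 1 \<in> {1..n}" using that by auto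
      have "rev_compl n \<pi> i = Suc n - \<pi> (n - i + 1)" "rev_compl n \<pi> (i + 1) = Suc n - \<pi> (n - i)"
        using that by (auto simp: rev_compl_def Suc_diff_le)
      thus ?thesis
        using perms_range[OF assms mem(1)] perms_range[OF assms mem(2)]
        unfolding atLeastAtMost_iff by linarith
    qed
    show "(\<lambda>i. n - i) ` {i \<in> {1..n - 1}. rev_compl n \<pi> i > rev_compl n \<pi> (i + 1)}
        \<subseteq> {i \<in> {1..n - 1}. \<pi> i > \<pi> (i + 1)}"
    proof (rule image_subsetI)
      fix i assume "i \<in> {i \<in> {1..n - 1}. rev_compl n \<pi> i > rev_compl n \<pi> (i + 1)}"
      thus "n - i \<in> {i \<in> {1..n - 1}. \<pi> i > \<pi> (i + 1)}" using iff[of i] by auto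
    qed
    show "(\<lambda>i. n - i) ` {i \<in> {1..n - 1}. \<pi> i > \<pi> (i + 1)}
        \<subseteq> {i \<in> {1..n - 1}. rev_compl n \<pi> i > rev_compl n \<pi> (i + 1)}"
    proof (rule image_subsetI)
      fix i assume i: "i \<in> {i \<in> {1..n - 1}. \<pi> i > \<pi> (i + 1)}"
      hence "n - i \<in> {1..n - 1}" "n - (n - i) = i" by auto
      thus "n - i \<in> {i \<in> {1..n - 1}. rev_compl n \<pi> i > rev_compl n \<pi> (i + 1)}"
        using iff[of "n - i"] i by auto
    qed
  qed auto
  thus ?thesis unfolding des_def by (rule bij_betw_same_card)
qed

lemma ides_rev_compl:
  assumes "\<pi> \<in> perms n"
  shows "ides n (rev_compl n \<pi>) = ides n \<pi>"
proof -
  have "inv \<pi> \<in> perms n" using assms by (simp add: perms_def permutes_inv)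
  thus ?thesis unfolding ides_def inv_rev_compl[OF assms] by (rule des_rev_compl)
qed

text \<open>The half turn reverses both positions and values, hence takes right-to-left maxima to
  left-to-right minima.\<close>

lemma lmin_rev_compl:
  assumes "\<pi> \<in> perms n"
  shows "lmin n (rev_compl n \<pi>) = rmax n \<pi>"
proof -
  let ?L = "\<lambda>i. i \<in> {1..n} \<and> (\<forall>j\<in>{1..n}. j < i \<longrightarrow> rev_compl n \<pi> i < rev_compl n \<pi> j)"
  let ?R = "\<lambda>i. i \<in> {1..n} \<and> (\<forall>j\<in>{1..n}. j > i \<longrightarrow> \<pi> i > \<pi> j)"
  have val: "rev_compl n \<pi> (Suc n - i) = Suc n - \<pi> i" if "i \<in> {1..n}" for i
    using that by (auto simp: rev_compl_def)
  have less: "Suc n - \<pi> i < Suc n - \<pi> j \<longleftrightarrow> \<pi> i > \<pi> j" if "i \<in> {1..n}" "j \<in> {1..n}" for i j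
    using perms_range[OF assms that(1)] perms_range[OF assms that(2)]
    unfolding atLeastAtMost_iff by linarith
  have iff: "?L (Suc n - i) \<longleftrightarrow> ?R i" if i: "i \<in> {1..n}" for i
  proof -
    have "(\<forall>j\<in>{1..n}. j < Suc n - i \<longrightarrow> rev_compl n \<pi> (Suc n - i) < rev_compl n \<pi> j) \<longleftrightarrow>
        (\<forall>j\<in>{1..n}. Suc n - j < Suc n - i \<longrightarrow> rev_compl n \<pi> (Suc n - i) < rev_compl n \<pi> (Suc n - j))"
    proof -
      let ?P = "\<lambda>j. j < Suc n - i \<longrightarrow> rev_compl n \<pi> (Suc n - i) < rev_compl n \<pi> j"
      have "(\<lambda>j. Suc n - j) ` {1..n} = {1..n}"
      proof (intro subset_antisym subsetI)
        fix j assume "j \<in> {1..n}"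
        thus "j \<in> (\<lambda>j. Suc n - j) ` {1..n}" by (intro image_eqI[of _ _ "Suc n - j"]) auto
      qed auto
      moreover have "(\<forall>j\<in>(\<lambda>j. Suc n - j) ` {1..n}. ?P j) \<longleftrightarrow> (\<forall>j\<in>{1..n}. ?P (Suc n - j))" by blast
      ultimately show ?thesis by (simp only:)
    qed
    also have "\<dots> \<longleftrightarrow> (\<forall>j\<in>{1..n}. j > i \<longrightarrow> \<pi> i > \<pi> j)"
    proof (rule ball_cong[OF refl])
      fix j assume j: "j \<in> {1..n}"
      have "Suc n - j < Suc n - i \<longleftrightarrow> j > i" using i j by auto
      thus "(Suc n - j < Suc n - i \<longrightarrow> rev_compl n \<pi> (Suc n - i) < rev_compl n \<pi> (Suc n - j)) \<longleftrightarrow>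
          (j > i \<longrightarrow> \<pi> i > \<pi> j)"
        unfolding val[OF i] val[OF j] less[OF i j] by simp
    qed
    finally show ?thesis using i by auto
  qed
  have "{rev_compl n \<pi> i | i. ?L i} = (\<lambda>m. Suc n - m) ` {\<pi> i | i. ?R i}"
  proof (intro subset_antisym subsetI)
    fix m assume "m \<in> {rev_compl n \<pi> i | i. ?L i}"
    then obtain i where i: "?L i" "m = rev_compl n \<pi> i" by blast
    hence "Suc n - i \<in> {1..n}" "Suc n - (Suc n - i) = i" by auto
    hence "?R (Suc n - i)" "m = Suc n - \<pi> (Suc n - i)"
      using i iff[of "Suc n - i"] val[of "Suc n - i"] by simp_all
    thus "m \<in> (\<lambda>m. Suc n - m) ` {\<pi> i | i. ?R i}" by blast
  next
    fix m assume "m \<in> (\<lambda>m. Suc n - m) ` {\<pi> i | i. ?R i}"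
    then obtain i where i: "?R i" "m = Suc n - \<pi> i" by blast
    hence "?L (Suc n - i)" "m = rev_compl n \<pi> (Suc n - i)" using iff[of i] val[of i] by simp_all
    thus "m \<in> {rev_compl n \<pi> i | i. ?L i}" by blast
  qed
  moreover have "inj_on (\<lambda>m. Suc n - m) {\<pi> i | i. ?R i}"
  proof (rule inj_on_subset)
    show "inj_on (\<lambda>m. Suc n - m) {1..n}" by (rule inj_onI) auto
    show "{\<pi> i | i. ?R i} \<subseteq> {1..n}" using perms_range[OF assms] by blast
  qed
  ultimately show ?thesis unfolding lmin_def rmax_def by (simp only: card_image)
qed

lemma rmax_rev_compl:
  assumes "\<pi> \<in> perms n"
  shows "rmax n (rev_compl n \<pi>) = lmin n \<pi>"
  using lmin_rev_compl[OF rev_compl_perms[OF assms]] unfolding rev_compl_involution[OF assms]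
  by (rule sym)

lemma inv_perms: "\<pi> \<in> perms n \<Longrightarrow> inv \<pi> \<in> perms n"
  by (simp add: perms_def permutes_inv)

lemma inv_inv_perms: "\<pi> \<in> perms n \<Longrightarrow> inv (inv \<pi>) = \<pi>"
  unfolding perms_def mem_Collect_eq by (rule inv_inv_eq[OF permutes_bij])

lemma bij_betw_inv: "bij_betw inv (perms n) (perms n)"
  by (rule bij_betw_byWitness[where f' = inv]) (auto simp: inv_inv_perms intro: inv_perms)

lemma ides_inv: "\<pi> \<in> perms n \<Longrightarrow> ides n (inv \<pi>) = des n \<pi>"
  by (simp add: ides_def inv_inv_perms)

text \<open>A left-to-right minimum is a point of the graph with no other point weakly south-west of it,
  a condition that is symmetric under transposing the graph.\<close>

lemma records_inv:
  fixes less :: "nat \<Rightarrow> nat \<Rightarrow> bool"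
  assumes "\<pi> \<in> perms n" and tot: "\<And>i j. i \<noteq> j \<Longrightarrow> less i j \<longleftrightarrow> \<not> less j i" and irr: "\<And>i. \<not> less i i"
  shows "card {inv \<pi> i | i. i \<in> {1..n} \<and> (\<forall>j\<in>{1..n}. less j i \<longrightarrow> less (inv \<pi> i) (inv \<pi> j))} =
    card {\<pi> i | i. i \<in> {1..n} \<and> (\<forall>j\<in>{1..n}. less j i \<longrightarrow> less (\<pi> i) (\<pi> j))}"
proof -
  have \<pi>: "\<pi> permutes {1..n}" using assms(1) by (simp add: perms_def)
  let ?A = "{i \<in> {1..n}. \<forall>j\<in>{1..n}. less j i \<longrightarrow> less (\<pi> i) (\<pi> j)}"
  have ne: "\<pi> i \<noteq> \<pi> j" if "i \<noteq> j" for i j using permutes_inj[OF \<pi>] that by (simp add: inj_eq)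
  have "{inv \<pi> i | i. i \<in> {1..n} \<and> (\<forall>j\<in>{1..n}. less j i \<longrightarrow> less (inv \<pi> i) (inv \<pi> j))} =
      {i. \<pi> i \<in> {1..n} \<and> (\<forall>j\<in>{1..n}. less j (\<pi> i) \<longrightarrow> less i (inv \<pi> j))}"
  proof (intro set_eqI iffI)
    fix x assume "x \<in> {inv \<pi> i | i. i \<in> {1..n} \<and> (\<forall>j\<in>{1..n}. less j i \<longrightarrow> less (inv \<pi> i) (inv \<pi> j))}"
    then obtain i where i: "x = inv \<pi> i" "i \<in> {1..n}"
      "\<forall>j\<in>{1..n}. less j i \<longrightarrow> less (inv \<pi> i) (inv \<pi> j)" by blast
    have "\<pi> x = i" unfolding i(1) by (rule permutes_inverses(1)[OF \<pi>])
    thus "x \<in> {i. \<pi> i \<in> {1..n} \<and> (\<forall>j\<in>{1..n}. less j (\<pi> i) \<longrightarrow> less i (inv \<pi> j))}" using i by simp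
  next
    fix x assume "x \<in> {i. \<pi> i \<in> {1..n} \<and> (\<forall>j\<in>{1..n}. less j (\<pi> i) \<longrightarrow> less i (inv \<pi> j))}"
    moreover have "inv \<pi> (\<pi> x) = x" by (rule permutes_inverses(2)[OF \<pi>])
    ultimately show "x \<in> {inv \<pi> i | i. i \<in> {1..n} \<and> (\<forall>j\<in>{1..n}. less j i \<longrightarrow> less (inv \<pi> i) (inv \<pi> j))}"
      by (intro CollectI exI[of _ "\<pi> x"]) simp
  qed
  also have "\<dots> = ?A"
  proof (rule Collect_cong)
    fix i
    have "(\<forall>j\<in>{1..n}. less j (\<pi> i) \<longrightarrow> less i (inv \<pi> j)) \<longleftrightarrow>
        (\<forall>j\<in>{1..n}. less (\<pi> j) (\<pi> i) \<longrightarrow> less i j)"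
    proof -
      have "(\<forall>j\<in>\<pi> ` {1..n}. less j (\<pi> i) \<longrightarrow> less i (inv \<pi> j)) \<longleftrightarrow>
          (\<forall>j\<in>{1..n}. less (\<pi> j) (\<pi> i) \<longrightarrow> less i j)"
        by (simp add: permutes_inverses(2)[OF \<pi>])
      thus ?thesis by (simp only: permutes_image[OF \<pi>])
    qed
    \<comment> \<open>For \<open>i \<noteq> j\<close> the two implications are contrapositives of
      each other, because \<open>less\<close> is total; for \<open>i = j\<close> both hold
      vacuously.\<close>
    also have "\<dots> \<longleftrightarrow> (\<forall>j\<in>{1..n}. less j i \<longrightarrow> less (\<pi> i) (\<pi> j))"
    proof (rule ball_cong[OF refl])
      fix j
      show "(less (\<pi> j) (\<pi> i) \<longrightarrow> less i j) \<longleftrightarrow> (less j i \<longrightarrow> less (\<pi> i) (\<pi> j))"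
        using tot[of i j] tot[OF ne[of i j]] irr by (cases "i = j") auto
    qed
    finally show "(\<pi> i \<in> {1..n} \<and> (\<forall>j\<in>{1..n}. less j (\<pi> i) \<longrightarrow> less i (inv \<pi> j))) \<longleftrightarrow>
        (i \<in> {1..n} \<and> (\<forall>j\<in>{1..n}. less j i \<longrightarrow> less (\<pi> i) (\<pi> j)))"
      by (simp only: permutes_in_image[OF \<pi>])
  qed
  finally have A: "{inv \<pi> i | i. i \<in> {1..n} \<and> (\<forall>j\<in>{1..n}. less j i \<longrightarrow> less (inv \<pi> i) (inv \<pi> j))} = ?A" .
  have "\<pi> ` ?A = {\<pi> i | i. i \<in> {1..n} \<and> (\<forall>j\<in>{1..n}. less j i \<longrightarrow> less (\<pi> i) (\<pi> j))}"
    by auto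
  moreover have "card (\<pi> ` ?A) = card ?A"
    by (rule card_image) (rule inj_on_subset[OF permutes_inj[OF \<pi>]], simp)
  ultimately show ?thesis unfolding A by (simp only:)
qed

lemma lmin_inv: "\<pi> \<in> perms n \<Longrightarrow> lmin n (inv \<pi>) = lmin n \<pi>"
  unfolding lmin_def by (rule records_inv[where less = "(<)"]) auto

text \<open>Right-to-left maxima are left-to-right minima for the reversed order on positions and
  values.\<close>

lemma rmax_inv: "\<pi> \<in> perms n \<Longrightarrow> rmax n (inv \<pi>) = rmax n \<pi>"
  unfolding rmax_def by (rule records_inv[where less = "\<lambda>i j. i > j"]) auto

text \<open>Setting \<open>z = 1\<close> suppresses the left-to-right maxima, which the half turn
  would take to right-to-left minima.\<close>

lemma gen_fun_rev_compl: "gen_fun t x u v q 1 = gen_fun t x u q v 1"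
proof -
  have "gen_fun_term t x u v q 1 n = gen_fun_term t x u q v 1 n" for n
    unfolding gen_fun_term_def
  proof (rule arg_cong[of _ _ "\<lambda>s. t ^ n * s"])
    let ?f = "\<lambda>\<pi>. u ^ des n \<pi> * x ^ ides n \<pi> * q ^ lmin n \<pi> * v ^ rmax n \<pi> * 1 ^ lmax n \<pi> /
      ((1 - u) ^ n * (1 - x) ^ n)"
    have "(\<Sum>\<pi>\<in>perms n. ?f \<pi>) = (\<Sum>\<pi>\<in>perms n. ?f (rev_compl n \<pi>))"
      by (rule sum.reindex_bij_betw[OF bij_betw_rev_compl, where g = ?f, symmetric])
    also have "\<dots> = (\<Sum>\<pi>\<in>perms n. u ^ des n \<pi> * x ^ ides n \<pi> * v ^ lmin n \<pi> * q ^ rmax n \<pi> * 1 ^ lmax n \<pi> /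
      ((1 - u) ^ n * (1 - x) ^ n))"
      by (rule sum.cong[OF refl]) (simp only: des_rev_compl ides_rev_compl lmin_rev_compl rmax_rev_compl power_one mult_1_right ac_simps)
    finally show "(\<Sum>\<pi>\<in>perms n. ?f \<pi>) = \<dots>" .
  qed
  hence "gen_fun_term t x u v q 1 = gen_fun_term t x u q v 1" by (rule ext)
  thus ?thesis by (simp only: gen_fun_def)
qed

lemma gen_fun_inv: "gen_fun t x u v q 1 = gen_fun t u x v q 1"
proof -
  have "gen_fun_term t x u v q 1 n = gen_fun_term t u x v q 1 n" for n
    unfolding gen_fun_term_def
  proof (rule arg_cong[of _ _ "\<lambda>s. t ^ n * s"])
    let ?f = "\<lambda>\<pi>. u ^ des n \<pi> * x ^ ides n \<pi> * q ^ lmin n \<pi> * v ^ rmax n \<pi> * 1 ^ lmax n \<pi> /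
      ((1 - u) ^ n * (1 - x) ^ n)"
    have "(\<Sum>\<pi>\<in>perms n. ?f \<pi>) = (\<Sum>\<pi>\<in>perms n. ?f (inv \<pi>))"
      by (rule sum.reindex_bij_betw[OF bij_betw_inv, where g = ?f, symmetric])
    also have "\<dots> = (\<Sum>\<pi>\<in>perms n. x ^ des n \<pi> * u ^ ides n \<pi> * q ^ lmin n \<pi> * v ^ rmax n \<pi> * 1 ^ lmax n \<pi> /
      ((1 - x) ^ n * (1 - u) ^ n))"
      by (rule sum.cong[OF refl]) (simp only: ides_inv ides_def[symmetric] lmin_inv rmax_inv power_one mult_1_right ac_simps)
    finally show "(\<Sum>\<pi>\<in>perms n. ?f \<pi>) = \<dots>" .
  qed
  hence "gen_fun_term t x u v q 1 = gen_fun_term t u x v q 1" by (rule ext)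
  thus ?thesis by (simp only: gen_fun_def)
qed

lemma equidistributed_bij:
  assumes "bij_betw h S S" "\<And>s. s \<in> S \<Longrightarrow> f (h s) = g s"
  shows "equidistributed S f g"
  unfolding equidistributed_def
proof
  fix w
  have "{s \<in> S. f s = w} = h ` {s \<in> S. g s = w}"
    using assms bij_betw_imp_surj_on[OF assms(1)] by force
  moreover have "inj_on h {s \<in> S. g s = w}"
    using bij_betw_imp_inj_on[OF assms(1)] by (rule inj_on_subset) auto
  ultimately show "card {s \<in> S. f s = w} = card {s \<in> S. g s = w}" by (simp add: card_image)
qed

theorem theorem1:
  fixes v q :: "'a::field_char_0"
  shows
    "gen_fun var_t var_x var_u (const_K v) (const_K q) 1 =
       const_K v * var_t / (1 - var_x) * fps3_infsum (numerator_term v q) {1..} *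
       inverse (1 - var_u * (const_K q - 1) / (var_x - 1) * fps3_infsum (denominator_term v q) {1..})
     \<and> gen_fun var_t var_x var_u (const_K v) (const_K q) 1 =
       gen_fun var_t var_x var_u (const_K q) (const_K v) 1
     \<and> gen_fun var_t var_x var_u (const_K q) (const_K v) 1 =
       gen_fun var_t var_u var_x (const_K q) (const_K v) 1
     \<and> (\<forall>n\<ge>1.
          equidistributed (perms n)
            (\<lambda>\<pi>. (des n \<pi>, ides n \<pi>, rmax n \<pi>, lmin n \<pi>))
            (\<lambda>\<pi>. (des n \<pi>, ides n \<pi>, lmin n \<pi>, rmax n \<pi>)) \<and>
          equidistributed (perms n)
            (\<lambda>\<pi>. (des n \<pi>, ides n \<pi>, lmin n \<pi>, rmax n \<pi>))
            (\<lambda>\<pi>. (ides n \<pi>, des n \<pi>, rmax n \<pi>, lmin n \<pi>)))"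
proof (intro conjI allI impI)
  fix n
  show "equidistributed (perms n)
      (\<lambda>\<pi>. (des n \<pi>, ides n \<pi>, rmax n \<pi>, lmin n \<pi>))
      (\<lambda>\<pi>. (des n \<pi>, ides n \<pi>, lmin n \<pi>, rmax n \<pi>))"
    by (rule equidistributed_bij[OF bij_betw_rev_compl])
      (simp add: des_rev_compl ides_rev_compl lmin_rev_compl rmax_rev_compl)
  \<comment> \<open>Inversion exchanges \<open>des\<close> and \<open>ides\<close> and keeps both
    records; the half turn that follows exchanges the records and keeps the descents.\<close>
  show "equidistributed (perms n)
      (\<lambda>\<pi>. (des n \<pi>, ides n \<pi>, lmin n \<pi>, rmax n \<pi>))
      (\<lambda>\<pi>. (ides n \<pi>, des n \<pi>, rmax n \<pi>, lmin n \<pi>))"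
    by (rule equidistributed_bij[OF bij_betw_trans[OF bij_betw_inv bij_betw_rev_compl]])
      (simp add: inv_perms des_rev_compl ides_rev_compl lmin_rev_compl rmax_rev_compl
        ides_inv lmin_inv rmax_inv ides_def[symmetric])
qed (rule gen_fun_formula gen_fun_rev_compl gen_fun_inv)+

end
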